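(* Let $k\ge 3$ and $m\ge 2$, and let $G$ be a $k$-uniform unicyclic hypergraph of size $m$ whose transmission is minimum among all $k$-uniform unicyclic hypergraphs of size $m$. Then $G\cong C_{3k-3,k}$ if $m=3$, and $G\cong C^k_2(m-2,0)$ if $m=2$ or $m\ge 4$.
   Context: A hypergraph $G=(V,E)$ has a finite nonempty vertex set $V$ and a family $E$ of subsets of $V$ (edges); it is $k$-uniform if every edge has exactly $k$ vertices; its size is $|E|$. A walk is an alternating sequence $(v_0,e_1,v_1,\dots,e_p,v_p)$ of vertices and edges with $v_{i-1}\ne v_i$ and $v_{i-1},v_i\in e_i$; its length is $p$. A path is a walk with all $v_i$ distinct and all $e_i$ distinct. A cycle is a walk with at least two edges, all $e_i$ distinct, and all $v_i$ distinct except $v_0=v_p$. $G$ is connected if any two vertices are joined by a path; it is unicyclic if it is connected and has exactly one cycle. The distance $d_G(u,v)$ is the length of a shortest path from $u$ to $v$, and the transmission is $\sigma(G)=\sum_{\{u,v\}\subseteq V(G)} d_G(u,v)$ over unordered pairs of distinct vertices. $C_{3k-3,k}$ (the $k$-uniform loose cycle with $3$ edges) has vertices $v_1,\dots,v_{3(k-1)}$ and edges $e_i=\{v_{(i-1)(k-1)+1},\dots,v_{(i-1)(k-1)+k}\}$ for $i=1,2,3$, with the convention $v_{3(k-1)+1}=v_1$. $C^k_2(m-2,0)$ denotes the $k$-uniform hypergraph consisting of two edges $e_1,e_2$ with $|e_1\cap e_2|=2$, say $e_1\cap e_2=\{u,w\}$, together with $m-2$ further edges, each of which consists of $u$ and $k-1$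 new vertices, these sets of new vertices being pairwise disjoint and disjoint from $e_1\cup e_2$ (i.e. a loose cycle of length $2$ with $m-2$ pendant edges attached at one of the two vertices common to the cycle edges); for $m=2$ it is just the two edges $e_1,e_2$. *)

theory Defs
  imports Main
begin

record 'a hypergraph =
  verts :: "'a set"
  edges :: "'a set set"

definition hypergraph :: "'a hypergraph \<Rightarrow> bool" where
  "hypergraph G \<longleftrightarrow> finite (verts G) \<and> verts G \<noteq> {} \<and> edges G \<subseteq> Pow (verts G)"

definition uniform :: "nat \<Rightarrow> 'a hypergraph \<Rightarrow> bool" where
  "uniform k G \<longleftrightarrow> (\<forall>e\<in>edges G. card e = k)"

text \<open>
  The alternating sequence \<open>(v\<^sub>0, e\<^sub>1, v\<^sub>1, \<dots>, e\<^sub>p, v\<^sub>p)\<close> is given by the two lists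
  \<open>vs = [v\<^sub>0, \<dots>, v\<^sub>p]\<close> and \<open>es = [e\<^sub>1, \<dots>, e\<^sub>p]\<close>, so \<open>es ! i\<close> joins \<open>vs ! i\<close> to \<open>vs ! Suc i\<close>.
\<close>

definition walk :: "'a hypergraph \<Rightarrow> 'a list \<Rightarrow> 'a set list \<Rightarrow> bool" where
  "walk G vs es \<longleftrightarrow>
     length vs = Suc (length es) \<and> set vs \<subseteq> verts G \<and> set es \<subseteq> edges G \<and>
     (\<forall>i<length es. vs ! i \<noteq> vs ! Suc i \<and> vs ! i \<in> es ! i \<and> vs ! Suc i \<in> es ! i)"

definition path :: "'a hypergraph \<Rightarrow> 'a list \<Rightarrow> 'a set list \<Rightarrow> bool" where
  "path G vs es \<longleftrightarrow> walk G vs es \<and> distinct vs \<and> distinct es"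

definition cycle :: "'a hypergraph \<Rightarrow> 'a list \<Rightarrow> 'a set list \<Rightarrow> bool" where
  "cycle G vs es \<longleftrightarrow>
     walk G vs es \<and> length es \<ge> 2 \<and> distinct es \<and> distinct (butlast vs) \<and> hd vs = last vs"

definition path_between :: "'a hypergraph \<Rightarrow> 'a \<Rightarrow> 'a \<Rightarrow> 'a list \<Rightarrow> 'a set list \<Rightarrow> bool" where
  "path_between G u v vs es \<longleftrightarrow> path G vs es \<and> hd vs = u \<and> last vs = v"

definition connected :: "'a hypergraph \<Rightarrow> bool" where
  "connected G \<longleftrightarrow> (\<forall>u\<in>verts G. \<forall>v\<in>verts G. \<exists>vs es. path_between G u v vs es)"

text \<open>
  Cycles are counted without regard to starting point and direction of traversal: two cyclic
  walks are the same cycle if they differ by a rotation, possibly after a reversal. The final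
  vertex repeats the first one and is dropped before rotating.
\<close>

definition same_cycle :: "'a list \<Rightarrow> 'a set list \<Rightarrow> 'a list \<Rightarrow> 'a set list \<Rightarrow> bool" where
  "same_cycle vs es vs' es' \<longleftrightarrow>
     (\<exists>n. butlast vs' = rotate n (butlast vs) \<and> es' = rotate n es) \<or>
     (\<exists>n. butlast vs' = rotate n (butlast (rev vs)) \<and> es' = rotate n (rev es))"

definition unicyclic :: "'a hypergraph \<Rightarrow> bool" where
  "unicyclic G \<longleftrightarrow> connected G \<and>
     (\<exists>vs es. cycle G vs es \<and> (\<forall>vs' es'. cycle G vs' es' \<longrightarrow> same_cycle vs es vs' es'))"

definition distance :: "'a hypergraph \<Rightarrow> 'a \<Rightarrow> 'a \<Rightarrow> nat" where
  "distance G u v = (LEAST n. \<exists>vs es. path_between G u v vs es \<and> length es = n)"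

text \<open>
  The summation index ranges over the unordered pairs \<open>S = {u, v}\<close> of distinct vertices; the
  summand is well defined because the distance is symmetric (\<open>distance_commute\<close> below).
\<close>

definition transmission :: "'a hypergraph \<Rightarrow> nat" where
  "transmission G =
     (\<Sum>S\<in>{S. S \<subseteq> verts G \<and> card S = 2}. THE d. \<forall>u v. S = {u, v} \<longrightarrow> d = distance G u v)"

definition isomorphic :: "'a hypergraph \<Rightarrow> 'b hypergraph \<Rightarrow> bool" where
  "isomorphic G H \<longleftrightarrow>
     (\<exists>f. bij_betw f (verts G) (verts H) \<and> edges H = (\<lambda>e. f ` e) ` edges G)"

text \<open>The vertex \<open>v\<^sub>j\<close> of \<open>C\<^bsub>3k-3,k\<^esub>\<close> is the number \<open>j\<close>.\<close>

definition loose_cycle3 :: "nat \<Rightarrow> nat hypergraph" where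
  "loose_cycle3 k =
     \<lparr>verts = {1..3 * (k - 1)},
      edges = (\<lambda>i. (\<lambda>j. if j = 3 * (k - 1) + 1 then 1 else j) `
                     {(i - 1) * (k - 1) + 1..(i - 1) * (k - 1) + k}) ` {1..3}\<rparr>"

text \<open>
  \<open>pendant_cycle2 k s\<close> is \<open>C\<^sup>k\<^sub>2(s, 0)\<close>, with \<open>u = 0\<close> and \<open>w = 1\<close>. The cycle edges \<open>{..<k}\<close> and
  \<open>{0, 1} \<union> {k..<2k-2}\<close> cover the numbers below \<open>2(k-1)\<close>; after that, each of the \<open>s\<close> pendant
  edges at \<open>u\<close> takes the next block of \<open>k-1\<close> numbers. Meaningful for \<open>k \<ge> 2\<close>.
\<close>

definition pendant_cycle2 :: "nat \<Rightarrow> nat \<Rightarrow> nat hypergraph" where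
  "pendant_cycle2 k s =
     \<lparr>verts = {..<(s + 2) * (k - 1)},
      edges = {{..<k}, {0, 1} \<union> {k..<2 * k - 2}} \<union>
              (\<lambda>j. insert 0 {(j + 2) * (k - 1)..<(j + 3) * (k - 1)}) ` {..<s}\<rparr>"

lemma path_rev:
  assumes "path G vs es"
  shows "path G (rev vs) (rev es)"
proof -
  have len: "length vs = Suc (length es)"
    and step: "\<And>i. i < length es \<Longrightarrow> vs ! i \<noteq> vs ! Suc i \<and> vs ! i \<in> es ! i \<and> vs ! Suc i \<in> es ! i"
    using assms by (auto simp: path_def walk_def)
  have "rev vs ! i \<noteq> rev vs ! Suc i \<and> rev vs ! i \<in> rev es ! i \<and> rev vs ! Suc i \<in> rev es ! i"
    if i: "i < length es" for i
  proof -
    let ?j = "length es - Suc i"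
    have "rev vs ! i = vs ! Suc ?j" "rev vs ! Suc i = vs ! ?j" "rev es ! i = es ! ?j"
      using i len by (simp_all add: rev_nth Suc_diff_Suc)
    moreover have "?j < length es" using i by linarith
    ultimately show ?thesis using step[of ?j] by auto
  qed
  then show ?thesis using assms by (auto simp: path_def walk_def)
qed

lemma distance_commute: "distance G u v = distance G v u"
proof -
  have "\<exists>vs es. path_between G v u vs es \<and> length es = n"
    if "path_between G u v vs es" "length es = n" for u v :: 'a and n vs es
  proof -
    have "vs \<noteq> []" using that by (auto simp: path_between_def path_def walk_def)
    then have "path_between G v u (rev vs) (rev es)"
      using that path_rev by (auto simp: path_between_def hd_rev last_rev)
    then show ?thesis using that(2) length_rev by blast
  qed
  then show ?thesis unfolding distance_def by (intro arg_cong[where f = Least] ext iffI) blast+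
qed

end

theory Submission
  imports Defs
begin

text \<open>
  A connected \<open>k\<close>-uniform hypergraph with \<open>m\<close> edges is built by adding edges one at a time, each
  meeting the part already built; an edge meeting it in two vertices closes a cycle, so a unicyclic
  hypergraph has at least \<open>m(k - 1)\<close> vertices. If \<open>n\<close> is the number of vertices, \<open>D\<close> the number of
  pairs inside an edge and \<open>X\<close> the number of pairs at distance at least 3, then the transmission is at
  least \<open>2 (n choose 2) - D + X\<close>, while \<open>D \<le> m (k choose 2)\<close>. Both candidates attain \<open>n = m(k - 1)\<close>
  and \<open>X = 0\<close>, with \<open>D = m (k choose 2)\<close> for the triangle and one less for the star. A minimiser
  therefore has \<open>n = m(k - 1)\<close> and, unless \<open>m = 3\<close>, \<open>X + (m (k choose 2) - D) \<le> 1\<close>.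

  For \<open>m \<ge> 4\<close>, a degree count shows that without pendant edges every edge has \<open>k - 2\<close> vertices of
  degree 1 and meets only two others, which forces \<open>X \<ge> 2\<close>. With a pendant edge attached at \<open>v\<close>, a
  vertex not adjacent to \<open>v\<close> would yield \<open>k - 1 \<ge> 2\<close> pairs at distance 3, so every vertex is adjacent
  to \<open>v\<close>; counting the vertices modulo \<open>k - 1\<close> shows that two edges overlap in a second vertex
  besides \<open>v\<close>, and then that every edge contains \<open>v\<close>.
\<close>

section \<open>Paths and distances\<close>

text \<open>Reachability under the closure of this relation replaces explicit walks in inductions.
  The family \<open>F\<close> is a parameter so that reachability inside a part of the edges can be
  expressed as well.\<close>

definition adj :: "'a set set \<Rightarrow> ('a \<times> 'a) set" where
  "adj F = {(x, y). \<exists>e\<in>F. x \<in> e \<and> y \<in> e}"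

lemma path_take:
  assumes "path G vs es" "i \<le> length es"
  shows "path G (take (Suc i) vs) (take i es)"
  using assms unfolding path_def walk_def
  by (auto simp: min_def dest: in_set_takeD)

lemma path_snoc:
  assumes "path G vs es" "e \<in> edges G" "z \<in> verts G" "last vs \<in> e" "z \<in> e"
    "z \<notin> set vs" "e \<notin> set es"
  shows "path G (vs @ [z]) (es @ [e])"
proof -
  have len: "length vs = Suc (length es)"
    using assms(1) by (auto simp: path_def walk_def)
  then have "vs \<noteq> []" by auto
  then have last: "last vs = vs ! length es" using len by (simp add: last_conv_nth)
  have "last vs \<in> set vs" using len by (intro last_in_set) auto
  then have "last vs \<noteq> z" using assms(6) by auto
  then show ?thesis
    using assms len last unfolding path_def walk_def
    by (auto simp: nth_append less_Suc_eq)
qed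

text \<open>Appending \<open>e\<close> directly to a path could repeat a vertex or an edge. The path
  is therefore cut at its first vertex in \<open>e\<close>: every edge kept contains an earlier
  vertex, which is not in \<open>e\<close>, so \<open>e\<close> is new, and \<open>z\<close>, lying
  in \<open>e\<close>, can be on the kept part only as its last vertex.\<close>

lemma adj_rtrancl_imp_path:
  assumes "(a, b) \<in> (adj F)\<^sup>*" "a \<in> verts G" "F \<subseteq> edges G" "edges G \<subseteq> Pow (verts G)"
  shows "\<exists>vs es. path_between G a b vs es \<and> set es \<subseteq> F"
  using assms(1)
proof (induction rule: rtrancl_induct)
  case base
  have "path_between G a a [a] []"
    using assms(2) by (auto simp: path_between_def path_def walk_def)
  then show ?case by (intro exI[of _ "[a]"] exI[of _ "[]"]) auto
next
  case (step y z)
  then obtain vs es where P: "path G vs es" "hd vs = a" "last vs = y" "set es \<subseteq> F"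
    by (auto simp: path_between_def)
  from step obtain e where e: "e \<in> F" "y \<in> e" "z \<in> e" by (auto simp: adj_def)
  have len: "length vs = Suc (length es)" using P by (auto simp: path_def walk_def)
  have ne: "vs \<noteq> []" using len by auto
  have "vs ! length es \<in> e" using P(3) e len ne by (simp add: last_conv_nth)
  then have ex: "\<exists>i. i \<le> length es \<and> vs ! i \<in> e" by blast
  define i where "i = (LEAST i. i \<le> length es \<and> vs ! i \<in> e)"
  have i: "i \<le> length es" "vs ! i \<in> e" using LeastI_ex[OF ex] by (auto simp: i_def)
  have before: "vs ! j \<notin> e" if "j < i" for j
    using not_less_Least[of j "\<lambda>i. i \<le> length es \<and> vs ! i \<in> e"] that i by (auto simp: i_def)
  let ?vs = "take (Suc i) vs" and ?es = "take i es"
  have path: "path G ?vs ?es" by (rule path_take[OF P(1) i(1)])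
  have hd: "hd ?vs = a" using P(2) by (simp add: hd_take)
  have last: "last ?vs = vs ! i"
    using i len by (simp add: take_Suc_conv_app_nth)
  have sub: "set ?es \<subseteq> F" using P(4) by (auto dest: in_set_takeD)
  show ?case
  proof (cases "z = vs ! i")
    case True
    \<comment> \<open>The cut already ends in \<open>z\<close>, so nothing is appended.\<close>
    then show ?thesis using path hd last sub unfolding path_between_def by metis
  next
    case False
    have "z \<notin> set ?vs"
    proof
      assume "z \<in> set ?vs"
      then obtain j where "j < Suc i" "z = vs ! j" by (auto simp: in_set_conv_nth)
      then show False using before[of j] e False by (cases "j = i") auto
    qed
    moreover have "e \<notin> set ?es"
    proof
      assume "e \<in> set ?es"
      then obtain j where "j < i" "e = es ! j" using i by (auto simp: in_set_conv_nth)
      then show False using before[of j] P(1) i by (auto simp: path_def walk_def)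
    qed
    ultimately have "path G (?vs @ [z]) (?es @ [e])"
      using path e last i assms by (intro path_snoc) auto
    moreover have "hd (?vs @ [z]) = a" using hd ne by (simp add: hd_append)
    ultimately have "path_between G a z (?vs @ [z]) (?es @ [e])"
      by (simp add: path_between_def)
    moreover have "set (?es @ [e]) \<subseteq> F" using sub e by auto
    ultimately show ?thesis by blast
  qed
qed

lemma walk_imp_adj_rtrancl:
  assumes "walk G vs es" "i \<le> length es"
  shows "(vs ! 0, vs ! i) \<in> (adj (edges G))\<^sup>*"
  using assms(2)
proof (induction i)
  case (Suc i)
  then have "vs ! i \<in> es ! i" "vs ! Suc i \<in> es ! i" "es ! i \<in> edges G"
    using assms(1) by (auto simp: walk_def)
  then have "(vs ! i, vs ! Suc i) \<in> adj (edges G)" by (auto simp: adj_def)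
  then show ?case using Suc by (auto intro: rtrancl_into_rtrancl)
qed auto

lemma connected_iff:
  assumes "hypergraph G"
  shows "connected G \<longleftrightarrow> (\<forall>u\<in>verts G. \<forall>v\<in>verts G. (u, v) \<in> (adj (edges G))\<^sup>*)"
proof
  assume con: "connected G"
  show "\<forall>u\<in>verts G. \<forall>v\<in>verts G. (u, v) \<in> (adj (edges G))\<^sup>*"
  proof (intro ballI)
    fix u v assume "u \<in> verts G" "v \<in> verts G"
    then have "\<exists>vs es. path_between G u v vs es" using con by (simp add: connected_def)
    then obtain vs es where P: "walk G vs es" "hd vs = u" "last vs = v"
      unfolding path_between_def path_def by blast
    have "length vs = Suc (length es)" using P(1) by (auto simp: walk_def)
    moreover from this have "vs \<noteq> []" by auto
    ultimately have "u = vs ! 0" "v = vs ! length es"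
      using P(2,3) by (auto simp: hd_conv_nth last_conv_nth)
    then show "(u, v) \<in> (adj (edges G))\<^sup>*" using walk_imp_adj_rtrancl[OF P(1)] by simp
  qed
next
  assume *: "\<forall>u\<in>verts G. \<forall>v\<in>verts G. (u, v) \<in> (adj (edges G))\<^sup>*"
  have "edges G \<subseteq> Pow (verts G)" using assms by (simp add: hypergraph_def)
  then show "connected G" unfolding connected_def
    using * by (meson adj_rtrancl_imp_path order_refl)
qed

text \<open>Otherwise \<open>A\<close> would be closed under \<open>adj\<close>, and no vertex
  outside \<open>A\<close> could be reached from inside.\<close>

lemma crossing_edge:
  assumes "hypergraph G" "connected G" "A \<subseteq> verts G" "A \<noteq> {}" "A \<noteq> verts G"
  shows "\<exists>e\<in>edges G. e \<inter> A \<noteq> {} \<and> \<not> e \<subseteq> A"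
proof (rule ccontr)
  assume *: "\<not> ?thesis"
  obtain a b where ab: "a \<in> A" "b \<in> verts G" "b \<notin> A" using assms by auto
  then have "(a, b) \<in> (adj (edges G))\<^sup>*" using assms connected_iff[of G] by auto
  then have "b \<in> A" using ab(1)
  proof (induction rule: rtrancl_induct)
    case (step y z)
    then show ?case using * by (auto simp: adj_def)
  qed
  then show False using ab by simp
qed

lemma edges_cover:
  assumes "hypergraph G" "connected G" "card (verts G) \<ge> 2"
  shows "\<Union> (edges G) = verts G"
proof
  show "\<Union> (edges G) \<subseteq> verts G" using assms by (auto simp: hypergraph_def)
  show "verts G \<subseteq> \<Union> (edges G)"
  proof
    fix x assume x: "x \<in> verts G"
    have "verts G \<noteq> {x}"
    proof
      assume "verts G = {x}"
      then show False using assms(3) by simp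
    qed
    then have "\<exists>e\<in>edges G. e \<inter> {x} \<noteq> {} \<and> \<not> e \<subseteq> {x}"
      using x by (intro crossing_edge[OF assms(1,2)]) auto
    then show "x \<in> \<Union> (edges G)" by blast
  qed
qed

section \<open>Bounds on distances in terms of shared edges and meeting edges\<close>

lemma distance_le:
  assumes "path_between G u v vs es"
  shows "distance G u v \<le> length es"
  unfolding distance_def using assms by (intro Least_le) auto

text \<open>Connectivity makes the predicate under \<open>LEAST\<close> satisfiable; without a path
  the value of \<open>distance\<close> would be arbitrary.\<close>

lemma distance_path:
  assumes "connected G" "u \<in> verts G" "v \<in> verts G"
  shows "\<exists>vs es. path_between G u v vs es \<and> length es = distance G u v"
proof -
  have "\<exists>n vs es. path_between G u v vs es \<and> length es = n"
    using assms by (auto simp: connected_def)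
  from LeastI_ex[OF this] show ?thesis by (simp add: distance_def)
qed

lemma distance_le_1:
  assumes "hypergraph G" "e \<in> edges G" "u \<in> e" "v \<in> e" "u \<noteq> v"
  shows "distance G u v \<le> 1"
proof -
  have "path_between G u v [u, v] [e]"
    using assms by (auto simp: path_between_def path_def walk_def hypergraph_def)
  from distance_le[OF this] show ?thesis by simp
qed

lemma distance_le_2:
  assumes "hypergraph G" "e \<in> edges G" "f \<in> edges G" "u \<in> e" "v \<in> f" "z \<in> e" "z \<in> f" "u \<noteq> v"
  shows "distance G u v \<le> 2"
\<comment> \<open>The sequence through \<open>z\<close> is a path only if its three vertices and two
  edges are distinct. This can fail only if one of the edges contains both \<open>u\<close> and
  \<open>v\<close>, and then the distance is at most 1.\<close>
proof (cases "v \<in> e \<or> u \<in> f")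
  case True
  then have "distance G u v \<le> 1" using distance_le_1[OF assms(1)] assms by blast
  then show ?thesis by simp
next
  case False
  then have "path_between G u v [u, z, v] [e, f]"
    using assms by (auto simp: path_between_def path_def walk_def hypergraph_def less_Suc_eq)
  from distance_le[OF this] show ?thesis by simp
qed

lemma distance_ge_1:
  assumes "connected G" "u \<in> verts G" "v \<in> verts G" "u \<noteq> v"
  shows "distance G u v \<ge> 1"
proof (rule ccontr)
  assume "\<not> ?thesis"
  then have "distance G u v = 0" by simp
  then obtain vs es where P: "path_between G u v vs es" "length es = 0"
    using distance_path[OF assms(1-3)] by metis
  then have "length vs = 1" by (auto simp: path_between_def path_def walk_def)
  then show False using P assms by (auto simp: path_between_def length_Suc_conv)
qed

lemma distance_ge_2:
  assumes "connected G" "u \<in> verts G" "v \<in> verts G" "u \<noteq> v"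
    "\<And>e. e \<in> edges G \<Longrightarrow> \<not> {u, v} \<subseteq> e"
  shows "distance G u v \<ge> 2"
proof (rule ccontr)
  assume "\<not> ?thesis"
  then have "distance G u v = 1" using distance_ge_1[OF assms(1-4)] by simp
  then obtain vs es where P: "path_between G u v vs es" "length es = 1"
    using distance_path[OF assms(1-3)] by metis
  then have "length vs = 2" by (auto simp: path_between_def path_def walk_def)
  then show False using P assms(5)
    by (auto simp: path_between_def path_def walk_def length_Suc_conv numeral_2_eq_2)
qed

lemma distance_ge_3:
  assumes "connected G" "u \<in> verts G" "v \<in> verts G" "u \<noteq> v"
    and sep: "\<And>e f. e \<in> edges G \<Longrightarrow> f \<in> edges G \<Longrightarrow> u \<in> e \<Longrightarrow> v \<in> f \<Longrightarrow> e \<inter> f = {}"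
  shows "distance G u v \<ge> 3"
proof (rule ccontr)
  \<comment> \<open>Taking \<open>e = f\<close> in \<open>sep\<close> excludes an edge containing
    both vertices, because \<open>u\<close> would lie in the empty set
    \<open>e \<inter> e\<close>.\<close>
  have "distance G u v \<ge> 2" using sep by (intro distance_ge_2 assms(1-4)) blast
  moreover assume "\<not> ?thesis"
  ultimately have "distance G u v = 2" by simp
  then obtain vs es where P: "path_between G u v vs es" "length es = 2"
    using distance_path[OF assms(1-3)] by metis
  then have "length vs = 3" by (auto simp: path_between_def path_def walk_def)
  then obtain x y z e f where "vs = [x, y, z]" "es = [e, f]" using P(2)
    by (auto simp: length_Suc_conv numeral_2_eq_2 numeral_3_eq_3)
  with P sep[of e f] show False
    by (auto simp: path_between_def path_def walk_def less_Suc_eq all_conj_distrib)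
qed

section \<open>Bounds on the transmission by counting pairs of vertices\<close>

definition pairs :: "'a set \<Rightarrow> 'a set set" where
  "pairs A = {S. S \<subseteq> A \<and> card S = 2}"

text \<open>By \<open>distance_ge_3\<close> these pairs have distance at least 3 in a connected
  hypergraph. Stating this through edges allows membership to be established without handling
  paths.\<close>

definition far_pairs :: "'a hypergraph \<Rightarrow> 'a set set" where
  "far_pairs G = {S \<in> pairs (verts G). \<exists>x y. S = {x, y} \<and>
     (\<forall>e\<in>edges G. \<forall>f\<in>edges G. x \<in> e \<longrightarrow> y \<in> f \<longrightarrow> e \<inter> f = {})}"

lemma finite_pairs [simp]: "finite A \<Longrightarrow> finite (pairs A)"
  by (auto simp: pairs_def)

lemma card_pairs: "finite A \<Longrightarrow> card (pairs A) = card A choose 2"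
  unfolding pairs_def by (rule n_subsets)

lemma pairsE:
  assumes "S \<in> pairs A"
  obtains x y where "S = {x, y}" "x \<noteq> y" "x \<in> A" "y \<in> A"
  using assms by (auto simp: pairs_def card_2_iff)

lemma pairs_mono: "A \<subseteq> B \<Longrightarrow> pairs A \<subseteq> pairs B"
  by (auto simp: pairs_def)

lemma UN_pairs_subset:
  assumes "hypergraph G"
  shows "(\<Union>e\<in>edges G. pairs e) \<subseteq> pairs (verts G)"
proof
  fix S assume "S \<in> (\<Union>e\<in>edges G. pairs e)"
  then obtain e where "e \<in> edges G" "S \<in> pairs e" by blast
  moreover from this have "e \<subseteq> verts G" using assms by (auto simp: hypergraph_def)
  ultimately show "S \<in> pairs (verts G)" using pairs_mono by blast
qed

lemma doubleton_in_pairs [simp]: "{x, y} \<in> pairs A \<longleftrightarrow> x \<in> A \<and> y \<in> A \<and> x \<noteq> y"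
  by (cases "x = y") (auto simp: pairs_def)

lemma pair_distance: "(THE d. \<forall>u v. {x, y} = {u, v} \<longrightarrow> d = distance G u v) = distance G x y"
  by (rule the_equality) (auto simp: doubleton_eq_iff distance_commute)

lemma sum_of_bool_mem:
  assumes "finite P" "N \<subseteq> P"
  shows "(\<Sum>S\<in>P. of_bool (S \<in> N)) = card N"
proof -
  have "P \<inter> {S. S \<in> N} = N" using assms by auto
  then show ?thesis using assms by simp
qed

text \<open>Every pair is charged 2, with a rebate of 1 if it lies in an edge and a surcharge of 1
  if it is far; comparing the charges pair by pair gives the sum. The rebate stands on the
  right-hand side to avoid subtraction on naturals.\<close>

lemma transmission_ge:
  assumes "hypergraph G" "connected G"
  shows "2 * (card (verts G) choose 2) + card (far_pairs G)
    \<le> transmission G + card (\<Union>e\<in>edges G. pairs e)"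
proof -
  let ?P = "pairs (verts G)" and ?N = "\<Union>e\<in>edges G. pairs e"
  have fin: "finite ?P" using assms by (simp add: hypergraph_def)
  have N: "?N \<subseteq> ?P" using assms(1) by (rule UN_pairs_subset)
  have F: "far_pairs G \<subseteq> ?P" by (auto simp: far_pairs_def)
  let ?d = "\<lambda>S. THE d. \<forall>u v. S = {u, v} \<longrightarrow> d = distance G u v"
  have "2 + of_bool (S \<in> far_pairs G) \<le> ?d S + of_bool (S \<in> ?N)" if S_pair: "S \<in> ?P" for S
  proof -
    obtain x y where S: "S = {x, y}" "x \<noteq> y" "x \<in> verts G" "y \<in> verts G"
      using S_pair by (rule pairsE)
    have d: "?d S = distance G x y" unfolding S(1) by (rule pair_distance)
    have d1: "distance G x y \<ge> 1" using distance_ge_1[OF assms(2)] S by auto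
    show ?thesis
    proof (cases "S \<in> far_pairs G")
      case True
      then have "\<forall>e\<in>edges G. \<forall>f\<in>edges G. x \<in> e \<longrightarrow> y \<in> f \<longrightarrow> e \<inter> f = {}"
        using S(1) unfolding far_pairs_def by (auto simp: doubleton_eq_iff)
      then have "distance G x y \<ge> 3" using S by (intro distance_ge_3 assms(2)) auto
      then show ?thesis using d by simp
    next
      case False
      show ?thesis
      proof (cases "S \<in> ?N")
        case True
        then show ?thesis using False d d1 by simp
      next
        case notN: False
        then have "distance G x y \<ge> 2" using S by (intro distance_ge_2 assms(2)) auto
        then show ?thesis using d False by simp
      qed
    qed
  qed
  then have "(\<Sum>S\<in>?P. 2 + of_bool (S \<in> far_pairs G)) \<le> (\<Sum>S\<in>?P. ?d S + of_bool (S \<in> ?N))"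
    by (rule sum_mono)
  moreover have "(\<Sum>S\<in>?P. of_bool (S \<in> far_pairs G)) = card (far_pairs G)"
    using fin F by (rule sum_of_bool_mem)
  moreover have "(\<Sum>S\<in>?P. of_bool (S \<in> ?N)) = card ?N"
    using fin N by (rule sum_of_bool_mem)
  moreover have "(\<Sum>S\<in>?P. ?d S) = transmission G" by (simp add: transmission_def pairs_def)
  moreover have "card ?P = card (verts G) choose 2"
    using assms by (intro card_pairs) (simp add: hypergraph_def)
  ultimately show ?thesis unfolding sum.distrib by simp
qed

text \<open>When any two edges meet, a common vertex gives distance at most 2, and a pair inside an
  edge has distance at most 1. This is the matching upper bound, to be applied to the two
  candidates.\<close>

lemma transmission_le:
  assumes "hypergraph G" "\<Union> (edges G) = verts G"
    and meet: "\<And>e f. e \<in> edges G \<Longrightarrow> f \<in> edges G \<Longrightarrow> e \<inter> f \<noteq> {}"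
  shows "transmission G + card (\<Union>e\<in>edges G. pairs e) \<le> 2 * (card (verts G) choose 2)"
proof -
  let ?P = "pairs (verts G)" and ?N = "\<Union>e\<in>edges G. pairs e"
  have fin: "finite ?P" using assms by (simp add: hypergraph_def)
  have N: "?N \<subseteq> ?P" using assms(1) by (rule UN_pairs_subset)
  let ?d = "\<lambda>S. THE d. \<forall>u v. S = {u, v} \<longrightarrow> d = distance G u v"
  have "?d S + of_bool (S \<in> ?N) \<le> 2" if S_pair: "S \<in> ?P" for S
  proof -
    obtain x y where S: "S = {x, y}" "x \<noteq> y" "x \<in> verts G" "y \<in> verts G"
      using S_pair by (rule pairsE)
    have d: "?d S = distance G x y" unfolding S(1) by (rule pair_distance)
    show ?thesis
    proof (cases "S \<in> ?N")
      case True
      then obtain e where "e \<in> edges G" "x \<in> e" "y \<in> e" using S by auto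
      then have "distance G x y \<le> 1" using distance_le_1[OF assms(1)] S by auto
      then show ?thesis using True d by simp
    next
      case False
      have "x \<in> \<Union> (edges G)" "y \<in> \<Union> (edges G)" using S assms(2) by auto
      then obtain e f where ef: "e \<in> edges G" "f \<in> edges G" "x \<in> e" "y \<in> f" by blast
      obtain z where "z \<in> e" "z \<in> f" using meet ef by blast
      then have "distance G x y \<le> 2" using distance_le_2[OF assms(1)] ef S by blast
      then show ?thesis using False d by simp
    qed
  qed
  then have "(\<Sum>S\<in>?P. ?d S + of_bool (S \<in> ?N)) \<le> (\<Sum>S\<in>?P. 2)"
    by (rule sum_mono)
  moreover have "(\<Sum>S\<in>?P. of_bool (S \<in> ?N)) = card ?N"
    using fin N by (rule sum_of_bool_mem)
  moreover have "(\<Sum>S\<in>?P. ?d S) = transmission G" by (simp add: transmission_def pairs_def)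
  moreover have "card ?P = card (verts G) choose 2"
    using assms by (intro card_pairs) (simp add: hypergraph_def)
  ultimately show ?thesis unfolding sum.distrib by simp
qed

section \<open>The order of a unicyclic hypergraph\<close>

lemma adj_mono: "F \<subseteq> F' \<Longrightarrow> adj F \<subseteq> adj F'"
  by (auto simp: adj_def)

lemma adj_rtrancl_sym: "(x, y) \<in> (adj F)\<^sup>* \<Longrightarrow> (y, x) \<in> (adj F)\<^sup>*"
proof -
  have "sym (adj F)" by (auto simp: sym_def adj_def)
  then show "(x, y) \<in> (adj F)\<^sup>* \<Longrightarrow> (y, x) \<in> (adj F)\<^sup>*" by (blast dest: sym_rtrancl symD)
qed

lemma cycle_of_path:
  assumes "path_between G a b vs es" "a \<noteq> b" "a \<in> e" "b \<in> e" "e \<in> edges G" "e \<notin> set es"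
  shows "cycle G (vs @ [a]) (es @ [e])"
proof -
  have P: "walk G vs es" "distinct vs" "distinct es" "hd vs = a" "last vs = b"
    using assms(1) by (auto simp: path_between_def path_def)
  have len: "length vs = Suc (length es)" using P(1) by (auto simp: walk_def)
  then have ne: "vs \<noteq> []" by auto
  have nth: "vs ! length es = b" using P(5) ne len by (simp add: last_conv_nth)
  have "es \<noteq> []"
  proof
    assume "es = []"
    then show False using P(4,5) assms(2) len by (auto simp: length_Suc_conv)
  qed
  then have "length es \<ge> 1" by (simp add: Suc_le_eq)
  moreover have "a \<in> verts G" using P(1,4) ne hd_in_set[of vs] by (auto simp: walk_def)
  then have "walk G (vs @ [a]) (es @ [e])"
    using P(1) len nth assms unfolding walk_def
    by (auto simp: nth_append less_Suc_eq)
  ultimately show ?thesis using P assms ne unfolding cycle_def by (simp add: hd_append)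
qed

text \<open>Comparing cycles by \<open>same_cycle\<close> drops one copy of the repeated vertex: the
  last one, or the first one when the list is reversed. Neither changes the vertex set.\<close>

lemma cycle_sets:
  assumes "cycle G vs es"
  shows "set (butlast vs) = set vs" "set (tl vs) = set vs"
proof -
  have "length vs = Suc (length es)" "length es \<ge> 2" and hd: "hd vs = last vs"
    using assms by (auto simp: cycle_def walk_def)
  then obtain x ys where vs: "vs = x # ys" "ys \<noteq> []"
    by (cases vs; cases "tl vs") auto
  then have "last ys = x" using hd by simp
  then have ys: "ys = butlast ys @ [x]" using vs(2) by (metis append_butlast_last_id)
  have "set (tl vs) = set ys" using vs by simp
  moreover have "x \<in> set ys" using ys by (metis in_set_conv_decomp)
  ultimately show "set (tl vs) = set vs" using vs by auto
  have "set (butlast vs) = insert x (set (butlast ys))" using vs by simp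
  also have "\<dots> = set (butlast ys @ [x])" by simp
  also have "\<dots> = set vs" using ys vs \<open>x \<in> set ys\<close> by auto
  finally show "set (butlast vs) = set vs" .
qed

lemma same_cycle_sets:
  assumes "cycle G vs es" "cycle G vs' es'" "same_cycle vs es vs' es'"
  shows "set vs' = set vs \<and> set es' = set es"
  using assms(3) unfolding same_cycle_def
proof (elim disjE exE conjE)
  fix n assume "butlast vs' = rotate n (butlast vs)" "es' = rotate n es"
  then show ?thesis using cycle_sets[OF assms(1)] cycle_sets[OF assms(2)] by (metis set_rotate)
next
  fix n assume "butlast vs' = rotate n (butlast (rev vs))" "es' = rotate n (rev es)"
  moreover have "butlast (rev vs) = rev (tl vs)" by (simp add: butlast_rev)
  ultimately show ?thesis
    using cycle_sets[OF assms(1)] cycle_sets[OF assms(2)] by (metis set_rotate set_rev)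
qed

text \<open>Rotation and reversal preserve the sets of vertices and edges. Uniqueness of the cycle
  enters the order bound in this form: two cycles that differ in either set give a
  contradiction.\<close>

lemma unicyclic_sets:
  assumes "unicyclic G" "cycle G vs es" "cycle G vs' es'"
  shows "set vs = set vs'" "set es = set es'"
proof -
  obtain us fs where U: "cycle G us fs" "\<And>vs es. cycle G vs es \<Longrightarrow> same_cycle us fs vs es"
    using assms(1) unfolding unicyclic_def by blast
  have "set vs = set us \<and> set es = set fs" "set vs' = set us \<and> set es' = set fs"
    using U assms(2,3) same_cycle_sets by metis+
  then show "set vs = set vs'" "set es = set es'" by simp_all
qed

text \<open>Connectivity of the subhypergraph with edge set \<open>F\<close> on the vertices that
  \<open>F\<close> covers. Reachability is taken in \<open>adj F\<close>, so that connecting paths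
  use edges of \<open>F\<close> only and avoid an edge added later.\<close>

definition linked :: "'a set set \<Rightarrow> bool" where
  "linked F \<longleftrightarrow> (\<forall>x\<in>\<Union>F. \<forall>y\<in>\<Union>F. (x, y) \<in> (adj F)\<^sup>*)"

lemma linked_insert:
  assumes "linked F" "e \<inter> \<Union>F \<noteq> {}"
  shows "linked (insert e F)"
proof -
  obtain z where z: "z \<in> e" "z \<in> \<Union>F" using assms(2) by blast
  have 1: "(x, z) \<in> (adj (insert e F))\<^sup>*" if "x \<in> \<Union>(insert e F)" for x
  proof (cases "x \<in> e")
    case True
    then have "(x, z) \<in> adj (insert e F)" using z by (auto simp: adj_def)
    then show ?thesis by blast
  next
    case False
    then have "(x, z) \<in> (adj F)\<^sup>*" using that z(2) assms(1) unfolding linked_def by blast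
    then show ?thesis using rtrancl_mono[OF adj_mono[of F "insert e F"]] by blast
  qed
  show ?thesis unfolding linked_def using 1 adj_rtrancl_sym rtrancl_trans by metis
qed

lemma linked_path:
  assumes "hypergraph G" "F \<subseteq> edges G" "linked F" "a \<in> \<Union>F" "b \<in> \<Union>F"
  shows "\<exists>vs es. path_between G a b vs es \<and> set es \<subseteq> F"
proof -
  have *: "edges G \<subseteq> Pow (verts G)" using assms(1) by (simp add: hypergraph_def)
  have "a \<in> verts G" using * assms(2,4) by blast
  moreover have "(a, b) \<in> (adj F)\<^sup>*" using assms(3-5) unfolding linked_def by blast
  ultimately show ?thesis
    using adj_rtrancl_imp_path[OF _ _ assms(2) *] by simp
qed

text \<open>A path between two of three vertices of \<open>e\<close> either avoids the third one or has an initial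
  segment avoiding its endpoint, so one of the two resulting cycles misses a vertex that another
  cycle through \<open>e\<close> contains.\<close>

lemma two_cycles:
  assumes "hypergraph G" "F \<subseteq> edges G" "linked F" "e \<in> edges G" "e \<notin> F"
    and abc: "{a, b, c} \<subseteq> e \<inter> \<Union>F" "a \<noteq> b" "a \<noteq> c" "b \<noteq> c"
  shows "\<exists>vs es vs' es'. cycle G vs es \<and> cycle G vs' es' \<and> set vs \<noteq> set vs'"
proof -
  \<comment> \<open>Here \<open>x\<close> and \<open>y\<close> stand for \<open>b\<close> and
    \<open>c\<close> in either order. The path missing \<open>y\<close> closes to a cycle without
    \<open>y\<close>, while any path from \<open>y\<close> to \<open>a\<close> inside
    \<open>F\<close> closes to a cycle through \<open>y\<close>.\<close>
  have main: ?thesis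
    if P: "path_between G a x vs es" "set es \<subseteq> F" "y \<notin> set vs"
      and xy: "x \<in> e" "y \<in> e" "y \<in> \<Union>F" "a \<noteq> x" "a \<noteq> y" for x y vs es
  proof -
    have "a \<in> \<Union>F" using abc(1) by blast
    then obtain vs' es' where P': "path_between G y a vs' es'" "set es' \<subseteq> F"
      using linked_path[OF assms(1-3) xy(3)] by blast
    have "cycle G (vs @ [a]) (es @ [e])"
      using P(2) xy abc assms(4,5) by (intro cycle_of_path[OF P(1)]) auto
    moreover have "cycle G (vs' @ [y]) (es' @ [e])"
      using P'(2) xy abc assms(4,5) by (intro cycle_of_path[OF P'(1)]) auto
    moreover have "set (vs @ [a]) \<noteq> set (vs' @ [y])" using P(3) xy by auto
    ultimately show ?thesis by blast
  qed
  have "a \<in> \<Union>F" "b \<in> \<Union>F" using abc(1) by blast+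
  then obtain vs es where P: "path_between G a b vs es" "set es \<subseteq> F"
    using linked_path[OF assms(1-3)] by metis
  show ?thesis
  proof (cases "c \<in> set vs")
    case False
    then show ?thesis using main[OF P False] abc by auto
  next
    case True
    have len: "length vs = Suc (length es)" and D: "distinct vs" and path: "path G vs es"
      and ends: "hd vs = a" "last vs = b"
      using P by (auto simp: path_between_def path_def walk_def)
    obtain i where i: "i < length vs" "vs ! i = c" using True by (auto simp: in_set_conv_nth)
    have b: "vs ! length es = b" using ends len by (metis last_conv_nth length_0_conv diff_Suc_1 nat.simps(3))
    then have "i \<noteq> length es" using i abc by auto
    then have lt: "i < length es" using i len by simp
    let ?vs = "take (Suc i) vs" and ?es = "take i es"
    have "path G ?vs ?es" using path_take[OF path] lt by simp
    moreover have "last ?vs = c" using i by (simp add: take_Suc_conv_app_nth)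
    moreover have "hd ?vs = a" using ends by (simp add: hd_take)
    ultimately have "path_between G a c ?vs ?es" by (simp add: path_between_def)
    moreover have "set ?es \<subseteq> F" using P(2) by (auto dest: in_set_takeD)
    moreover have "b \<notin> set ?vs"
    proof
      assume "b \<in> set ?vs"
      then obtain j where "j < Suc i" "vs ! j = b" by (auto simp: in_set_conv_nth)
      then show False using b D lt len by (auto simp: nth_eq_iff_index_eq)
    qed
    ultimately show ?thesis using main[of c ?vs ?es b] abc by auto
  qed
qed

text \<open>A new edge sharing \<open>c\<close> vertices with \<open>\<Union>F\<close> contributes
  \<open>k - c\<close> vertices. If \<open>c = 1\<close>, either bound is preserved. If
  \<open>c = 2\<close>, a cycle closes and the surplus vertex of the first alternative is spent,
  which can happen only once. By \<open>two_cycles\<close>, \<open>c \<ge> 3\<close> is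
  impossible.\<close>

lemma growing_subfamily:
  assumes G: "hypergraph G" "connected G" "uniform k G" "unicyclic G" and "k \<ge> 2"
  shows "1 \<le> j \<Longrightarrow> j \<le> card (edges G) \<Longrightarrow> \<exists>F. F \<subseteq> edges G \<and> card F = j \<and> linked F \<and>
    (j * (k - 1) + 1 \<le> card (\<Union>F) \<or>
     j * (k - 1) \<le> card (\<Union>F) \<and> (\<exists>vs es. cycle G vs es \<and> set es \<subseteq> F))"
proof (induction j rule: nat_induct_at_least)
  case base
  then obtain e where e: "e \<in> edges G" by fastforce
  have "linked {e}" unfolding linked_def by (auto simp: adj_def)
  then show ?case using e assms by (intro exI[of _ "{e}"]) (auto simp: uniform_def)
next
  case (Suc j)
  then obtain F where F: "F \<subseteq> edges G" "card F = j" "linked F"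
    and alt: "j * (k - 1) + 1 \<le> card (\<Union>F) \<or>
     j * (k - 1) \<le> card (\<Union>F) \<and> (\<exists>vs es. cycle G vs es \<and> set es \<subseteq> F)" by auto
  have E: "edges G \<subseteq> Pow (verts G)" "finite (verts G)" using G by (auto simp: hypergraph_def)
  then have fin: "finite F" "finite (\<Union>F)" using F(1)
    by (meson finite_Pow_iff finite_subset, meson E F(1) Sup_le_iff Pow_iff finite_subset subsetD)
  have ne: "e \<noteq> {}" if "e \<in> edges G" for e using that assms by (auto simp: uniform_def)
  have sub: "\<Union>F \<subseteq> verts G" using E F(1) by blast
  have "F \<noteq> {}" using F(2) Suc.hyps by auto
  then have nonempty: "\<Union>F \<noteq> {}" using ne F(1) by fastforce
  have "\<exists>e\<in>edges G. e \<notin> F \<and> e \<inter> \<Union>F \<noteq> {}"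
  proof (cases "\<Union>F = verts G")
    case True
    have "F \<noteq> edges G" using F(2) Suc.prems by auto
    then obtain e where "e \<in> edges G" "e \<notin> F" using F(1) by blast
    moreover from this have "e \<inter> \<Union>F = e" using True E(1) by blast
    ultimately show ?thesis using ne by metis
  next
    case False
    then obtain e where "e \<in> edges G" "e \<inter> \<Union>F \<noteq> {}" "\<not> e \<subseteq> \<Union>F"
      using crossing_edge[OF G(1,2) sub nonempty] by blast
    then show ?thesis by blast
  qed
  then obtain e where e: "e \<in> edges G" "e \<notin> F" "e \<inter> \<Union>F \<noteq> {}" by blast
  have ce: "card e = k" "finite e" using e(1) G(3) E by (auto simp: uniform_def intro: finite_subset)
  let ?F = "insert e F" and ?c = "card (e \<inter> \<Union>F)"
  have linked: "linked ?F" by (rule linked_insert[OF F(3) e(3)])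
  have cardF: "card ?F = Suc j" using F(2) e(2) fin by simp
  have count: "card (\<Union>?F) + ?c = card (\<Union>F) + k"
    using card_Un_Int[OF ce(2) fin(2)] ce(1) by simp
  have c1: "?c \<ge> 1" using e(3) ce(2) by (simp add: Suc_le_eq card_gt_0_iff)
  have mult: "Suc j * (k - 1) = j * (k - 1) + (k - 1)" by simp
  have "Suc j * (k - 1) + 1 \<le> card (\<Union>?F) \<or>
     Suc j * (k - 1) \<le> card (\<Union>?F) \<and> (\<exists>vs es. cycle G vs es \<and> set es \<subseteq> ?F)"
  proof (cases "?c = 1")
    case True
    then show ?thesis using alt count mult \<open>k \<ge> 2\<close> by (elim disjE conjE exE) (auto intro!: exI)
  next
    case False
    then have "?c \<ge> 2" using c1 by simp
    then obtain T where T: "T \<subseteq> e \<inter> \<Union>F" "card T = 2" by (meson obtain_subset_with_card_n)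
    then obtain a b where "T = {a, b}" "a \<noteq> b" by (auto simp: card_2_iff)
    then have ab: "a \<in> e \<inter> \<Union>F" "b \<in> e \<inter> \<Union>F" "a \<noteq> b" using T(1) by blast+
    then have "a \<in> \<Union>F" "b \<in> \<Union>F" by blast+
    then obtain vs es where P: "path_between G a b vs es" "set es \<subseteq> F"
      using linked_path[OF G(1) F(1,3)] by metis
    have C: "cycle G (vs @ [a]) (es @ [e])"
      using P(2) ab e by (intro cycle_of_path[OF P(1)]) auto
    \<comment> \<open>The cycle \<open>C\<close> contains \<open>e\<close>, whereas a cycle inside
      \<open>F\<close> does not, so both cannot exist. Hence the surplus vertex is still
      available.\<close>
    have "\<not> (\<exists>vs es. cycle G vs es \<and> set es \<subseteq> F)"
    proof (intro notI, elim exE conjE)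
      fix vs' es' assume "cycle G vs' es'" "set es' \<subseteq> F"
      then show False using unicyclic_sets(2)[OF G(4) C] e(2) by auto
    qed
    then have "j * (k - 1) + 1 \<le> card (\<Union>F)" using alt by blast
    moreover have "?c \<le> 2"
    proof (rule ccontr)
      assume "\<not> ?c \<le> 2"
      then have "3 \<le> ?c" by simp
      then obtain T where T: "T \<subseteq> e \<inter> \<Union>F" "card T = 3" by (meson obtain_subset_with_card_n)
      then obtain x y z where xyz: "T = {x, y, z}" "x \<noteq> y" "x \<noteq> z" "y \<noteq> z"
        by (auto simp: card_3_iff)
      then have "{x, y, z} \<subseteq> e \<inter> \<Union>F" using T(1) by simp
      from two_cycles[OF G(1) F(1,3) e(1,2) this xyz(2-4)]
      show False using unicyclic_sets(1)[OF G(4)] by blast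
    qed
    ultimately have "Suc j * (k - 1) \<le> card (\<Union>?F)" using count mult \<open>k \<ge> 2\<close> by linarith
    moreover have "set (es @ [e]) \<subseteq> ?F" using P(2) by auto
    ultimately show ?thesis using C by blast
  qed
  then show ?case using F(1) e(1) cardF linked by (intro exI[of _ ?F]) auto
qed

lemma unicyclic_order_ge:
  assumes "hypergraph G" "uniform k G" "unicyclic G" "k \<ge> 2" "card (edges G) \<ge> 1"
  shows "card (edges G) * (k - 1) \<le> card (verts G)"
proof -
  have "connected G" using assms by (simp add: unicyclic_def)
  then obtain F where F: "F \<subseteq> edges G" "card (edges G) * (k - 1) \<le> card (\<Union>F)"
    using growing_subfamily[OF assms(1) _ assms(2-4) assms(5) order_refl] by auto
  have "finite (verts G)" "\<Union>F \<subseteq> verts G" using assms(1) F(1) by (auto simp: hypergraph_def)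
  then show ?thesis using F(2) by (meson card_mono le_trans)
qed

section \<open>The two extremal shapes\<close>

text \<open>Isomorphisms are obtained by cutting both vertex sets into disjoint blocks, listed in
  corresponding order, and gluing bijections between blocks of equal size. The equation of lists
  records which block goes to which.\<close>

lemma glue_bij_list:
  assumes "list_all2 (\<lambda>A B. finite A \<and> finite B \<and> card A = card B) As Bs"
    "sorted_wrt (\<lambda>A A'. A \<inter> A' = {}) As" "sorted_wrt (\<lambda>B B'. B \<inter> B' = {}) Bs"
  shows "\<exists>f. bij_betw f (\<Union>(set As)) (\<Union>(set Bs)) \<and> map ((`) f) As = Bs"
  using assms
proof (induction rule: list_all2_induct)
  case Nil
  then show ?case by (auto simp: bij_betw_def)
next
  case (Cons A As B Bs)
  then obtain f where f: "bij_betw f (\<Union>(set As)) (\<Union>(set Bs))" "map ((`) f) As = Bs" by auto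
  obtain h where h: "bij_betw h A B" using Cons finite_same_card_bij by blast
  define g where "g x = (if x \<in> A then h x else f x)" for x
  have disj: "X \<inter> A = {}" if "X \<in> set As" for X using Cons.prems(1) that by auto
  have gA: "bij_betw g A B" using h bij_betw_cong[of A g h] by (simp add: g_def)
  moreover have "bij_betw g (\<Union>(set As)) (\<Union>(set Bs))"
  proof -
    have "g x = f x" if "x \<in> \<Union>(set As)" for x using that disj by (auto simp: g_def)
    then show ?thesis using f(1) bij_betw_cong[of "\<Union>(set As)" g f] by simp
  qed
  moreover have "B \<inter> \<Union>(set Bs) = {}" using Cons.prems(2) by auto
  ultimately have "bij_betw g (A \<union> \<Union>(set As)) (B \<union> \<Union>(set Bs))" by (rule bij_betw_combine)
  moreover have "g ` X = f ` X" if "X \<in> set As" for X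
    using disj[OF that] by (intro image_cong) (auto simp: g_def)
  then have "map ((`) g) As = Bs" using f(2) by auto
  moreover have "g ` A = B" using gA by (auto simp: bij_betw_def)
  ultimately show ?case by auto
qed

lemma connected_if_edges_meet:
  assumes "hypergraph G" "\<Union> (edges G) = verts G"
    and meet: "\<And>e f. e \<in> edges G \<Longrightarrow> f \<in> edges G \<Longrightarrow> e \<inter> f \<noteq> {}"
  shows "connected G"
  unfolding connected_iff[OF assms(1)]
proof (intro ballI)
  fix x y assume "x \<in> verts G" "y \<in> verts G"
  then have "x \<in> \<Union> (edges G)" "y \<in> \<Union> (edges G)" using assms(2) by auto
  then obtain e f where ef: "e \<in> edges G" "x \<in> e" "f \<in> edges G" "y \<in> f" by blast
  then obtain z where "z \<in> e" "z \<in> f" using meet by blast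
  with ef have "(x, z) \<in> adj (edges G)" "(z, y) \<in> adj (edges G)" by (auto simp: adj_def)
  then show "(x, y) \<in> (adj (edges G))\<^sup>*" by auto
qed

text \<open>The two vertices of the cycle on either side of \<open>e\<close> also lie in the
  preceding and the following edge, which differ from \<open>e\<close>. This excludes from every
  cycle an edge that shares only one vertex with the others.\<close>

lemma cycle_edge_vertices:
  assumes C: "cycle G vs es" and "e \<in> set es"
  shows "\<exists>x y. x \<noteq> y \<and> x \<in> e \<and> y \<in> e \<and> (\<exists>f\<in>edges G. f \<noteq> e \<and> x \<in> f) \<and>
    (\<exists>f\<in>edges G. f \<noteq> e \<and> y \<in> f)"
proof -
  obtain i where i: "i < length es" "es ! i = e" using assms(2) by (auto simp: in_set_conv_nth)
  have W: "length vs = Suc (length es)" "length es \<ge> 2" "distinct es" "set es \<subseteq> edges G"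
    and step: "\<And>j. j < length es \<Longrightarrow> vs ! j \<noteq> vs ! Suc j \<and> vs ! j \<in> es ! j \<and> vs ! Suc j \<in> es ! j"
    and "hd vs = last vs"
    using C by (auto simp: cycle_def walk_def)
  moreover from this have "vs \<noteq> []" by auto
  ultimately have ends: "vs ! 0 = vs ! length es" by (simp add: hd_conv_nth last_conv_nth)
  have other: "\<exists>f\<in>edges G. f \<noteq> e \<and> x \<in> f" if "j < length es" "j \<noteq> i" "x \<in> es ! j" for j x
  proof -
    have "es ! j \<noteq> e" using W(3) i that by (auto simp: nth_eq_iff_index_eq)
    moreover have "es ! j \<in> edges G" using W(4) that(1) nth_mem by blast
    ultimately show ?thesis using that by blast
  qed
  have "\<exists>f\<in>edges G. f \<noteq> e \<and> vs ! i \<in> f"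
  proof (cases i)
    \<comment> \<open>Cyclically the last edge precedes the first one, as
      \<open>vs ! 0 = vs ! length es\<close>.\<close>
    case 0
    have "Suc (length es - 1) = length es" using W(2) by simp
    then have "vs ! i \<in> es ! (length es - 1)"
      using step[of "length es - 1"] ends W(2) 0 by auto
    then show ?thesis using other[of "length es - 1"] W(2) 0 by simp
  next
    case (Suc i')
    then show ?thesis using other[of i'] step[of i'] i by simp
  qed
  moreover have "\<exists>f\<in>edges G. f \<noteq> e \<and> vs ! Suc i \<in> f"
  proof (cases "Suc i = length es")
    case True
    have "0 < length es" "0 \<noteq> i" using W(2) True by auto
    then have "\<exists>f\<in>edges G. f \<noteq> e \<and> vs ! 0 \<in> f" using other[of 0] step[of 0] by blast
    then show ?thesis using ends True by simp
  next
    case False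
    then show ?thesis using other[of "Suc i"] step[of "Suc i"] i by simp
  qed
  ultimately show ?thesis using step[OF i(1)] i(2) by blast
qed

lemma cycle_length_2:
  assumes "cycle G vs [p, q]"
  obtains x y where "vs = [x, y, x]" "x \<noteq> y" "{x, y} \<subseteq> p \<inter> q"
proof -
  have "length vs = 3" using assms by (simp add: cycle_def walk_def)
  then obtain x y z where "vs = [x, y, z]" by (auto simp: length_Suc_conv numeral_3_eq_3)
  then show ?thesis using assms that
    by (auto simp: cycle_def walk_def less_Suc_eq all_conj_distrib)
qed

lemma cycle_length_3:
  assumes "cycle G vs [p, q, r]"
  obtains x y z where "vs = [x, y, z, x]" "x \<in> r \<inter> p" "y \<in> p \<inter> q" "z \<in> q \<inter> r"
proof -
  have "length vs = 4" using assms by (simp add: cycle_def walk_def)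
  then obtain x y z t where "vs = [x, y, z, t]" by (auto simp: length_Suc_conv eval_nat_numeral)
  then show ?thesis using assms that
    by (auto simp: cycle_def walk_def less_Suc_eq all_conj_distrib)
qed

lemma pairs_disjoint:
  assumes "finite e" "card (e \<inter> f) \<le> 1"
  shows "pairs e \<inter> pairs f = {}"
proof (rule ccontr)
  assume "pairs e \<inter> pairs f \<noteq> {}"
  then obtain S where "S \<subseteq> e \<inter> f" "card S = 2" by (auto simp: pairs_def)
  then show False using card_mono[of "e \<inter> f" S] assms by simp
qed

lemma card_UN_pairs_linear:
  assumes "finite E" "\<And>e. e \<in> E \<Longrightarrow> finite e \<and> card e = k"
    "\<And>e f. e \<in> E \<Longrightarrow> f \<in> E \<Longrightarrow> e \<noteq> f \<Longrightarrow> card (e \<inter> f) \<le> 1"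
  shows "card (\<Union>e\<in>E. pairs e) = card E * (k choose 2)"
proof -
  have "card (\<Union>e\<in>E. pairs e) = (\<Sum>e\<in>E. card (pairs e))"
    using assms by (intro card_UN_disjoint) (auto simp: pairs_disjoint)
  also have "\<dots> = (\<Sum>e\<in>E. k choose 2)" using assms(2) by (intro sum.cong) (auto simp: card_pairs)
  finally show ?thesis by simp
qed

text \<open>A loose triangle described by edge sizes and intersections alone, so that the same facts
  serve the numbered \<open>loose_cycle3 k\<close> and an arbitrary minimiser. Distinctness of the
  corners \<open>a\<close>, \<open>b\<close>, \<open>c\<close> makes the triple intersection
  empty.\<close>

definition triangle_shape ::
    "nat \<Rightarrow> 'a hypergraph \<Rightarrow> 'a set \<Rightarrow> 'a set \<Rightarrow> 'a set \<Rightarrow> 'a \<Rightarrow> 'a \<Rightarrow> 'a \<Rightarrow> bool" where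
  "triangle_shape k G e\<^sub>1 e\<^sub>2 e\<^sub>3 a b c \<longleftrightarrow>
     edges G = {e\<^sub>1, e\<^sub>2, e\<^sub>3} \<and> verts G = e\<^sub>1 \<union> e\<^sub>2 \<union> e\<^sub>3 \<and>
     card e\<^sub>1 = k \<and> card e\<^sub>2 = k \<and> card e\<^sub>3 = k \<and>
     e\<^sub>3 \<inter> e\<^sub>1 = {a} \<and> e\<^sub>1 \<inter> e\<^sub>2 = {b} \<and> e\<^sub>2 \<inter> e\<^sub>3 = {c} \<and> a \<noteq> b \<and> a \<noteq> c \<and> b \<noteq> c"

text \<open>The analogous description of the two-edge cycle with \<open>s\<close> pendant edges at
  \<open>u\<close>, enumerated by \<open>g\<close>. For \<open>k \<ge> 3\<close> the prescribed
  intersections force \<open>g\<close> to be injective on the indices below \<open>s\<close> and to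
  avoid \<open>e\<^sub>1\<close> and \<open>e\<^sub>2\<close>.\<close>

definition star_shape ::
    "nat \<Rightarrow> 'a hypergraph \<Rightarrow> 'a set \<Rightarrow> 'a set \<Rightarrow> 'a \<Rightarrow> 'a \<Rightarrow> (nat \<Rightarrow> 'a set) \<Rightarrow> nat \<Rightarrow> bool" where
  "star_shape k G e\<^sub>1 e\<^sub>2 u w g s \<longleftrightarrow>
     edges G = {e\<^sub>1, e\<^sub>2} \<union> g ` {..<s} \<and> verts G = \<Union> (edges G) \<and> (\<forall>e\<in>edges G. card e = k) \<and>
     e\<^sub>1 \<inter> e\<^sub>2 = {u, w} \<and> u \<noteq> w \<and> (\<forall>j<s. g j \<inter> e\<^sub>1 = {u} \<and> g j \<inter> e\<^sub>2 = {u}) \<and>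
     (\<forall>i<s. \<forall>j<s. i \<noteq> j \<longrightarrow> g i \<inter> g j = {u})"

section \<open>Hypergraphs of the same shape are isomorphic\<close>

lemma isomorphic_if_triangle:
  assumes "k \<ge> 3"
    and G: "triangle_shape k G e\<^sub>1 e\<^sub>2 e\<^sub>3 a b c" and H: "triangle_shape k H d\<^sub>1 d\<^sub>2 d\<^sub>3 a' b' c'"
  shows "isomorphic G H"
proof -
  \<comment> \<open>The blocks are the three corners and, for each edge, its \<open>k - 2\<close>
    other vertices.\<close>
  let ?As = "[{a}, {b}, {c}, e\<^sub>1 - {a, b}, e\<^sub>2 - {b, c}, e\<^sub>3 - {c, a}]"
  let ?Bs = "[{a'}, {b'}, {c'}, d\<^sub>1 - {a', b'}, d\<^sub>2 - {b', c'}, d\<^sub>3 - {c', a'}]"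
  note G' = G[unfolded triangle_shape_def] and H' = H[unfolded triangle_shape_def]
  have mG: "a \<in> e\<^sub>1" "a \<in> e\<^sub>3" "b \<in> e\<^sub>1" "b \<in> e\<^sub>2" "c \<in> e\<^sub>2" "c \<in> e\<^sub>3" using G' by blast+
  have mH: "a' \<in> d\<^sub>1" "a' \<in> d\<^sub>3" "b' \<in> d\<^sub>1" "b' \<in> d\<^sub>2" "c' \<in> d\<^sub>2" "c' \<in> d\<^sub>3" using H' by blast+
  have "c \<noteq> a" "c' \<noteq> a'" using G' H' by blast+
  have fin: "finite e\<^sub>1" "finite e\<^sub>2" "finite e\<^sub>3" "finite d\<^sub>1" "finite d\<^sub>2" "finite d\<^sub>3"
    using G' H' assms(1) by (auto intro!: card_ge_0_finite)
  have "list_all2 (\<lambda>A B. finite A \<and> finite B \<and> card A = card B) ?As ?Bs"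
    using G' H' fin mG mH \<open>c \<noteq> a\<close> \<open>c' \<noteq> a'\<close> by (simp add: card_Diff_subset)
  moreover have "sorted_wrt (\<lambda>A A'. A \<inter> A' = {}) ?As"
    using G' by simp blast
  moreover have "sorted_wrt (\<lambda>B B'. B \<inter> B' = {}) ?Bs"
    using H' by simp blast
  ultimately have "\<exists>f. bij_betw f (\<Union>(set ?As)) (\<Union>(set ?Bs)) \<and> map ((`) f) ?As = ?Bs"
    by (rule glue_bij_list)
  then obtain f where f: "bij_betw f (\<Union>(set ?As)) (\<Union>(set ?Bs))" "map ((`) f) ?As = ?Bs"
    by (elim exE conjE)
  have "\<Union>(set ?As) = verts G" "\<Union>(set ?Bs) = verts H" using G' H' mG mH by auto
  then have "bij_betw f (verts G) (verts H)" using f(1) by simp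
  moreover have "f ` e\<^sub>1 = d\<^sub>1" "f ` e\<^sub>2 = d\<^sub>2" "f ` e\<^sub>3 = d\<^sub>3"
  proof -
    have *: "f a = a'" "f b = b'" "f c = c'" "f ` (e\<^sub>1 - {a, b}) = d\<^sub>1 - {a', b'}"
      "f ` (e\<^sub>2 - {b, c}) = d\<^sub>2 - {b', c'}" "f ` (e\<^sub>3 - {c, a}) = d\<^sub>3 - {c', a'}"
      using f(2) by simp_all
    have split: "e\<^sub>1 = {a, b} \<union> (e\<^sub>1 - {a, b})" "e\<^sub>2 = {b, c} \<union> (e\<^sub>2 - {b, c})"
      "e\<^sub>3 = {c, a} \<union> (e\<^sub>3 - {c, a})" using mG by auto
    show "f ` e\<^sub>1 = d\<^sub>1" by (subst split(1), subst image_Un) (use * mH in auto)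
    show "f ` e\<^sub>2 = d\<^sub>2" by (subst split(2), subst image_Un) (use * mH in auto)
    show "f ` e\<^sub>3 = d\<^sub>3" by (subst split(3), subst image_Un) (use * mH in auto)
  qed
  then have "edges H = (`) f ` edges G" using G' H' by simp
  ultimately show ?thesis unfolding isomorphic_def by blast
qed

lemma star_shape_parts_disjoint:
  assumes "star_shape k G e\<^sub>1 e\<^sub>2 u w g s"
  shows "sorted_wrt (\<lambda>A A'. A \<inter> A' = {})
    ([{u}, {w}, e\<^sub>1 - {u, w}, e\<^sub>2 - {u, w}] @ map (\<lambda>j. g j - {u}) [0..<s])"
proof -
  have e: "e\<^sub>1 \<inter> e\<^sub>2 = {u, w}" "u \<noteq> w"
    and g: "\<And>j. j < s \<Longrightarrow> g j \<inter> e\<^sub>1 = {u} \<and> g j \<inter> e\<^sub>2 = {u}"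
    and gg: "\<And>i j. i < s \<Longrightarrow> j < s \<Longrightarrow> i \<noteq> j \<Longrightarrow> g i \<inter> g j = {u}"
    using assms unfolding star_shape_def by simp_all
  have "sorted_wrt (\<lambda>A A'. A \<inter> A' = {}) (map (\<lambda>j. g j - {u}) [0..<s])"
    unfolding sorted_wrt_iff_nth_less
  proof (intro allI impI)
    fix i j assume "i < j" "j < length (map (\<lambda>j. g j - {u}) [0..<s])"
    then show "map (\<lambda>j. g j - {u}) [0..<s] ! i \<inter> map (\<lambda>j. g j - {u}) [0..<s] ! j = {}"
      using gg[of i j] by auto
  qed
  moreover have "sorted_wrt (\<lambda>A A'. A \<inter> A' = {}) [{u}, {w}, e\<^sub>1 - {u, w}, e\<^sub>2 - {u, w}]"
    using e by auto
  moreover have "A \<inter> (g j - {u}) = {}"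
    if "A \<in> set [{u}, {w}, e\<^sub>1 - {u, w}, e\<^sub>2 - {u, w}]" "j < s" for A j
    using that(1) g[OF that(2)] e by auto
  ultimately show ?thesis unfolding sorted_wrt_append by auto
qed

lemma isomorphic_if_star:
  assumes "k \<ge> 3"
    and G: "star_shape k G e\<^sub>1 e\<^sub>2 u w g s" and H: "star_shape k H d\<^sub>1 d\<^sub>2 u' w' h s"
  shows "isomorphic G H"
proof -
  \<comment> \<open>The blocks are \<open>u\<close>, \<open>w\<close>, the \<open>k - 2\<close>
    other vertices of each cycle edge, and the \<open>k - 1\<close> vertices besides
    \<open>u\<close> of each pendant edge.\<close>
  let ?As = "[{u}, {w}, e\<^sub>1 - {u, w}, e\<^sub>2 - {u, w}] @ map (\<lambda>j. g j - {u}) [0..<s]"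
  let ?Bs = "[{u'}, {w'}, d\<^sub>1 - {u', w'}, d\<^sub>2 - {u', w'}] @ map (\<lambda>j. h j - {u'}) [0..<s]"
  note G' = G[unfolded star_shape_def] and H' = H[unfolded star_shape_def]
  have mG: "u \<in> e\<^sub>1" "u \<in> e\<^sub>2" "w \<in> e\<^sub>1" "w \<in> e\<^sub>2" "\<And>j. j < s \<Longrightarrow> u \<in> g j" using G' by blast+
  have mH: "u' \<in> d\<^sub>1" "u' \<in> d\<^sub>2" "w' \<in> d\<^sub>1" "w' \<in> d\<^sub>2" "\<And>j. j < s \<Longrightarrow> u' \<in> h j" using H' by blast+
  have cG: "card e\<^sub>1 = k" "card e\<^sub>2 = k" "\<And>j. j < s \<Longrightarrow> card (g j) = k" using G' by auto
  have cH: "card d\<^sub>1 = k" "card d\<^sub>2 = k" "\<And>j. j < s \<Longrightarrow> card (h j) = k" using H' by auto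
  have fin: "finite e\<^sub>1" "finite e\<^sub>2" "finite d\<^sub>1" "finite d\<^sub>2"
    "\<And>j. j < s \<Longrightarrow> finite (g j) \<and> finite (h j)"
    using cG cH assms(1) by (auto intro!: card_ge_0_finite)
  have "list_all2 (\<lambda>A B. finite A \<and> finite B \<and> card A = card B) ?As ?Bs"
    using G' H' fin mG mH cG cH
    by (simp add: card_Diff_subset list_all2_map1 list_all2_map2 list_all2_same)
  moreover note star_shape_parts_disjoint[OF G] star_shape_parts_disjoint[OF H]
  ultimately have "\<exists>f. bij_betw f (\<Union>(set ?As)) (\<Union>(set ?Bs)) \<and> map ((`) f) ?As = ?Bs"
    by (rule glue_bij_list)
  then obtain f where f: "bij_betw f (\<Union>(set ?As)) (\<Union>(set ?Bs))" "map ((`) f) ?As = ?Bs"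
    by (elim exE conjE)
  have "\<Union>(set ?As) = verts G" using G' mG by (auto simp: atLeast0LessThan)
  moreover have "\<Union>(set ?Bs) = verts H" using H' mH by (auto simp: atLeast0LessThan)
  ultimately have bij: "bij_betw f (verts G) (verts H)" using f(1) by simp
  have "map (\<lambda>j. f ` (g j - {u})) [0..<s] = map (\<lambda>j. h j - {u'}) [0..<s]"
    using f(2) by (simp add: o_def del: map_eq_conv)
  then have rest: "f ` (g j - {u}) = h j - {u'}" if "j < s" for j
    using that by (simp only: map_eq_conv set_upt atLeastLessThan_iff Ball_def) blast
  have *: "f u = u'" "f w = w'" "f ` (e\<^sub>1 - {u, w}) = d\<^sub>1 - {u', w'}"
    "f ` (e\<^sub>2 - {u, w}) = d\<^sub>2 - {u', w'}"
    using f(2) by simp_all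
  have "f ` e\<^sub>1 = f ` ({u, w} \<union> (e\<^sub>1 - {u, w}))" using mG by (intro arg_cong[where f = "(`) f"]) auto
  also have "\<dots> = d\<^sub>1" using * mH by (auto simp only: image_Un)
  finally have 1: "f ` e\<^sub>1 = d\<^sub>1" .
  have "f ` e\<^sub>2 = f ` ({u, w} \<union> (e\<^sub>2 - {u, w}))" using mG by (intro arg_cong[where f = "(`) f"]) auto
  also have "\<dots> = d\<^sub>2" using * mH by (auto simp only: image_Un)
  finally have 2: "f ` e\<^sub>2 = d\<^sub>2" .
  have 3: "f ` g j = h j" if "j < s" for j
  proof -
    have "f ` g j = f ` ({u} \<union> (g j - {u}))"
      using mG(5)[OF that] by (intro arg_cong[where f = "(`) f"]) auto
    also have "\<dots> = h j" using *(1) rest[OF that] mH(5)[OF that] by (auto simp only: image_Un)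
    finally show ?thesis .
  qed
  have "(`) f ` edges G = {d\<^sub>1, d\<^sub>2} \<union> (\<lambda>j. f ` g j) ` {..<s}"
    using G' 1 2 by (simp add: image_Un image_image)
  also have "(\<lambda>j. f ` g j) ` {..<s} = h ` {..<s}" using 3 by (intro image_cong) auto
  finally have "edges H = (`) f ` edges G" using H' by simp
  with bij show ?thesis unfolding isomorphic_def by blast
qed

text \<open>A cycle uses two or three of the edges. Two do not suffice, because two edges share only
  one vertex. With all three, the order of the edges determines the vertices, and the six orders are
  the three rotations of each direction.\<close>

lemma triangle_unicyclic:
  assumes "hypergraph G" and T: "triangle_shape k G e\<^sub>1 e\<^sub>2 e\<^sub>3 a b c"
  shows "unicyclic G"
proof -
  have E: "edges G = {e\<^sub>1, e\<^sub>2, e\<^sub>3}" and V: "verts G = e\<^sub>1 \<union> e\<^sub>2 \<union> e\<^sub>3"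
    and I: "e\<^sub>3 \<inter> e\<^sub>1 = {a}" "e\<^sub>1 \<inter> e\<^sub>2 = {b}" "e\<^sub>2 \<inter> e\<^sub>3 = {c}" and N: "a \<noteq> b" "a \<noteq> c" "b \<noteq> c"
    using T by (simp_all add: triangle_shape_def)
  have M: "a \<in> e\<^sub>3" "a \<in> e\<^sub>1" "b \<in> e\<^sub>1" "b \<in> e\<^sub>2" "c \<in> e\<^sub>2" "c \<in> e\<^sub>3" using I by blast+
  have ne: "e\<^sub>1 \<noteq> e\<^sub>2" "e\<^sub>1 \<noteq> e\<^sub>3" "e\<^sub>2 \<noteq> e\<^sub>3" using I N M by auto
  have "connected G"
    using M E V by (intro connected_if_edges_meet[OF assms(1)]) auto
  moreover have "cycle G [a, b, c, a] [e\<^sub>1, e\<^sub>2, e\<^sub>3]"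
    using E V M N ne by (auto simp: cycle_def walk_def less_Suc_eq)
  moreover have "same_cycle [a, b, c, a] [e\<^sub>1, e\<^sub>2, e\<^sub>3] vs es" if C: "cycle G vs es" for vs es
  proof -
    have es: "distinct es" "length es \<ge> 2" "set es \<subseteq> {e\<^sub>1, e\<^sub>2, e\<^sub>3}"
      using C E by (auto simp: cycle_def walk_def)
    have "length es = card (set es)" using es(1) by (simp add: distinct_card)
    also have "\<dots> \<le> card {e\<^sub>1, e\<^sub>2, e\<^sub>3}" using es(3) by (intro card_mono) auto
    also have "\<dots> \<le> 3" by (simp add: card_insert_if)
    finally have "length es = 2 \<or> length es = 3" using es(2) by linarith
    then show ?thesis
    proof
      assume "length es = 2"
      then obtain p q where pq: "es = [p, q]" by (auto simp: length_Suc_conv numeral_2_eq_2)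
      obtain x y where "x \<noteq> y" and xy: "{x, y} \<subseteq> p \<inter> q"
        using cycle_length_2[OF C[unfolded pq]] by metis
      moreover have "p \<inter> q = {a} \<or> p \<inter> q = {b} \<or> p \<inter> q = {c}"
        using es pq I by (auto simp: Int_commute)
      ultimately have "x = y" using xy by (elim disjE) auto
      then show ?thesis using \<open>x \<noteq> y\<close> by simp
    next
      assume "length es = 3"
      then obtain p q r where pqr: "es = [p, q, r]" by (auto simp: length_Suc_conv numeral_3_eq_3)
      obtain x y z where vs: "vs = [x, y, z, x]" and xyz: "x \<in> r \<inter> p" "y \<in> p \<inter> q" "z \<in> q \<inter> r"
        using cycle_length_3[OF C[unfolded pqr]] .
      have cases: "p = e\<^sub>1 \<and> q = e\<^sub>2 \<and> r = e\<^sub>3 \<or> p = e\<^sub>2 \<and> q = e\<^sub>3 \<and> r = e\<^sub>1 \<or>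
        p = e\<^sub>3 \<and> q = e\<^sub>1 \<and> r = e\<^sub>2 \<or> p = e\<^sub>3 \<and> q = e\<^sub>2 \<and> r = e\<^sub>1 \<or>
        p = e\<^sub>2 \<and> q = e\<^sub>1 \<and> r = e\<^sub>3 \<or> p = e\<^sub>1 \<and> q = e\<^sub>3 \<and> r = e\<^sub>2"
      proof -
        have "p \<noteq> q" "p \<noteq> r" "q \<noteq> r" using es(1) pqr by simp_all
        moreover have "p = e\<^sub>1 \<or> p = e\<^sub>2 \<or> p = e\<^sub>3" "q = e\<^sub>1 \<or> q = e\<^sub>2 \<or> q = e\<^sub>3"
          "r = e\<^sub>1 \<or> r = e\<^sub>2 \<or> r = e\<^sub>3" using es(3) pqr by simp_all
        ultimately show ?thesis by (elim disjE) simp_all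
      qed
      have I': "e\<^sub>1 \<inter> e\<^sub>3 = {a}" "e\<^sub>2 \<inter> e\<^sub>1 = {b}" "e\<^sub>3 \<inter> e\<^sub>2 = {c}" using I by auto
      \<comment> \<open>Read backwards from \<open>a\<close>, the cycle visits \<open>c\<close>
        before \<open>b\<close> and starts with \<open>e\<^sub>3\<close>. Limiting the rotation
        amount to three values lets \<open>rotate\<close> be evaluated.\<close>
      have same: "(\<exists>n\<in>{0, 1, 2}. butlast vs = rotate n [a, b, c] \<and> es = rotate n [e\<^sub>1, e\<^sub>2, e\<^sub>3]) \<or>
        (\<exists>n\<in>{0, 1, 2}. butlast vs = rotate n [a, c, b] \<and> es = rotate n [e\<^sub>3, e\<^sub>2, e\<^sub>1])"
        using cases xyz I I' unfolding pqr vs by (elim disjE) (simp_all add: numeral_2_eq_2)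
      have rots: "butlast [a, b, c, a] = [a, b, c]" "butlast (rev [a, b, c, a]) = [a, c, b]"
        "rev [e\<^sub>1, e\<^sub>2, e\<^sub>3] = [e\<^sub>3, e\<^sub>2, e\<^sub>1]" by simp_all
      show ?thesis unfolding same_cycle_def rots
        by (rule disj_forward[OF same]) (erule bexE, erule exI)+
    qed
  qed
  ultimately show ?thesis unfolding unicyclic_def by blast
qed

lemma triangle_near_pairs:
  assumes T: "triangle_shape k G e\<^sub>1 e\<^sub>2 e\<^sub>3 a b c" and "k \<ge> 3"
  shows "card (edges G) = 3" "card (\<Union>e\<in>edges G. pairs e) = 3 * (k choose 2)"
proof -
  have E: "edges G = {e\<^sub>1, e\<^sub>2, e\<^sub>3}" and K: "card e\<^sub>1 = k" "card e\<^sub>2 = k" "card e\<^sub>3 = k"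
    and I: "e\<^sub>3 \<inter> e\<^sub>1 = {a}" "e\<^sub>1 \<inter> e\<^sub>2 = {b}" "e\<^sub>2 \<inter> e\<^sub>3 = {c}"
    using T by (simp_all add: triangle_shape_def)
  have I': "e\<^sub>1 \<inter> e\<^sub>3 = {a}" "e\<^sub>2 \<inter> e\<^sub>1 = {b}" "e\<^sub>3 \<inter> e\<^sub>2 = {c}" using I by auto
  have "e\<^sub>1 \<noteq> e\<^sub>2" "e\<^sub>1 \<noteq> e\<^sub>3" "e\<^sub>2 \<noteq> e\<^sub>3"
    using I I' K assms(2) by auto
  then show *: "card (edges G) = 3" using E by simp
  have "card (\<Union>e\<in>edges G. pairs e) = card (edges G) * (k choose 2)"
  proof (rule card_UN_pairs_linear)
    show "finite (edges G)" using E by simp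
    show "finite e \<and> card e = k" if "e \<in> edges G" for e
    proof -
      have "card e = k" using that E K by auto
      then show ?thesis using assms(2) by (auto intro: card_ge_0_finite)
    qed
    show "card (e \<inter> f) \<le> 1" if "e \<in> edges G" "f \<in> edges G" "e \<noteq> f" for e f
      using that I I' unfolding E by (elim insertE emptyE) simp_all
  qed
  then show "card (\<Union>e\<in>edges G. pairs e) = 3 * (k choose 2)" using * by simp
qed

text \<open>A pendant edge shares only \<open>u\<close> with the other edges, so by
  \<open>cycle_edge_vertices\<close> it is on no cycle. The remaining edges \<open>e\<^sub>1\<close>
  and \<open>e\<^sub>2\<close> close up only through \<open>u\<close> and \<open>w\<close>.\<close>

lemma star_unicyclic:
  assumes "hypergraph G" "k \<ge> 3" and S: "star_shape k G e\<^sub>1 e\<^sub>2 u w g s"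
  shows "unicyclic G"
proof -
  have E: "edges G = {e\<^sub>1, e\<^sub>2} \<union> g ` {..<s}" and V: "\<Union> (edges G) = verts G"
    and K: "\<And>e. e \<in> edges G \<Longrightarrow> card e = k"
    and I: "e\<^sub>1 \<inter> e\<^sub>2 = {u, w}" and N: "u \<noteq> w"
    and g: "\<And>j. j < s \<Longrightarrow> g j \<inter> e\<^sub>1 = {u} \<and> g j \<inter> e\<^sub>2 = {u}"
    and gg: "\<And>i j. i < s \<Longrightarrow> j < s \<Longrightarrow> i \<noteq> j \<Longrightarrow> g i \<inter> g j = {u}"
    using S by (simp_all add: star_shape_def)
  have M: "u \<in> e\<^sub>1" "u \<in> e\<^sub>2" "w \<in> e\<^sub>1" "w \<in> e\<^sub>2" using I by blast+
  have u: "u \<in> e" if "e \<in> edges G" for e using that E M g by auto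
  have ne: "e\<^sub>1 \<noteq> e\<^sub>2"
  proof
    assume "e\<^sub>1 = e\<^sub>2"
    then have "card e\<^sub>1 = card {u, w}" using I by simp
    then show False using K[of e\<^sub>1] E N assms(2) by simp
  qed
  have "connected G"
    using u by (intro connected_if_edges_meet[OF assms(1) V]) blast
  moreover have "cycle G [u, w, u] [e\<^sub>1, e\<^sub>2]"
    using E V M N ne by (auto simp: cycle_def walk_def less_Suc_eq)
  moreover have "same_cycle [u, w, u] [e\<^sub>1, e\<^sub>2] vs es" if C: "cycle G vs es" for vs es
  proof -
    have es: "distinct es" "length es \<ge> 2" "set es \<subseteq> edges G"
      using C by (auto simp: cycle_def walk_def)
    have sub: "e \<in> {e\<^sub>1, e\<^sub>2}" if e: "e \<in> set es" for e
    proof (rule ccontr)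
      assume "e \<notin> {e\<^sub>1, e\<^sub>2}"
      moreover have "e \<in> {e\<^sub>1, e\<^sub>2} \<union> g ` {..<s}" using e es(3) E by blast
      ultimately obtain j where j: "j < s" "e = g j" by blast
      have "e \<inter> f = {u}" if "f \<in> edges G" "f \<noteq> e" for f
        using that j g[OF j(1)] gg[OF j(1)] E by auto
      then have "z = u" if "z \<in> e" "\<exists>f\<in>edges G. f \<noteq> e \<and> z \<in> f" for z using that by blast
      then show False using cycle_edge_vertices[OF C e] by metis
    qed
    have "length es = card (set es)" using es(1) by (simp add: distinct_card)
    also have "\<dots> \<le> card {e\<^sub>1, e\<^sub>2}" using sub by (intro card_mono) auto
    also have "\<dots> \<le> 2" by (simp add: card_insert_if)
    finally have "length es = 2" using es(2) by linarith
    then obtain p q where pq: "es = [p, q]" by (auto simp: length_Suc_conv numeral_2_eq_2)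
    obtain x y where vs: "vs = [x, y, x]" "x \<noteq> y" and xy: "{x, y} \<subseteq> p \<inter> q"
      using cycle_length_2[OF C[unfolded pq]] .
    have pq12: "p = e\<^sub>1 \<and> q = e\<^sub>2 \<or> p = e\<^sub>2 \<and> q = e\<^sub>1" using es(1) pq sub by auto
    then have "{x, y} \<subseteq> {u, w}" using xy I by (metis Int_commute)
    then have "x = u \<and> y = w \<or> x = w \<and> y = u" using vs(2) by auto
    \<comment> \<open>The four cases are the choices of the first vertex and the first edge.
      Reversal leaves \<open>[u, w, u]\<close> unchanged, so the direction shows only in the list of
      edges.\<close>
    then have same: "(\<exists>n\<in>{0, 1}. butlast vs = rotate n [u, w] \<and> es = rotate n [e\<^sub>1, e\<^sub>2]) \<or>
        (\<exists>n\<in>{0, 1}. butlast vs = rotate n [u, w] \<and> es = rotate n [e\<^sub>2, e\<^sub>1])"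
      using pq12 unfolding pq vs(1) by (elim disjE) simp_all
    have rots: "butlast [u, w, u] = [u, w]" "butlast (rev [u, w, u]) = [u, w]"
      "rev [e\<^sub>1, e\<^sub>2] = [e\<^sub>2, e\<^sub>1]" by simp_all
    show ?thesis unfolding same_cycle_def rots
        by (rule disj_forward[OF same]) (erule bexE, erule exI)+
  qed
  ultimately show ?thesis unfolding unicyclic_def by blast
qed

text \<open>Without \<open>e\<^sub>2\<close>, any two edges share at most one vertex, so no pair is
  counted twice. Adding \<open>e\<^sub>2\<close> repeats at most the pair \<open>{u, w}\<close>,
  already contained in \<open>e\<^sub>1\<close>.\<close>

lemma star_near_pairs:
  assumes S: "star_shape k G e\<^sub>1 e\<^sub>2 u w g s" and "k \<ge> 3"
  shows "card (edges G) = s + 2" "(s + 2) * (k choose 2) \<le> card (\<Union>e\<in>edges G. pairs e) + 1"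
proof -
  have E: "edges G = {e\<^sub>1, e\<^sub>2} \<union> g ` {..<s}"
    and K: "\<And>e. e \<in> edges G \<Longrightarrow> card e = k"
    and I: "e\<^sub>1 \<inter> e\<^sub>2 = {u, w}" and N: "u \<noteq> w"
    and g: "\<And>j. j < s \<Longrightarrow> g j \<inter> e\<^sub>1 = {u} \<and> g j \<inter> e\<^sub>2 = {u}"
    and gg: "\<And>i j. i < s \<Longrightarrow> j < s \<Longrightarrow> i \<noteq> j \<Longrightarrow> g i \<inter> g j = {u}"
    using S by (simp_all add: star_shape_def)
  have fin: "finite e" if "e \<in> edges G" for e using K[OF that] assms(2) by (intro card_ge_0_finite) simp
  have "e\<^sub>1 \<noteq> e\<^sub>2"
  proof
    assume "e\<^sub>1 = e\<^sub>2"
    then have "card e\<^sub>1 = card {u, w}" using I by simp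
    then show False using K[of e\<^sub>1] E N assms(2) by simp
  qed
  have single: "e \<noteq> f" if "e \<in> edges G" "e \<inter> f = {u}" for e f
    using K[OF that(1)] that(2) assms(2) by auto
  have gE: "g j \<in> edges G" if "j < s" for j using E that by auto
  have ge: "g j \<noteq> e\<^sub>1" "g j \<noteq> e\<^sub>2" if "j < s" for j
    using single[OF gE[OF that]] g[OF that] by blast+
  have "inj_on g {..<s}"
  proof (rule inj_onI, rule ccontr)
    fix i j assume "i \<in> {..<s}" "j \<in> {..<s}" "g i = g j" "i \<noteq> j"
    then show False using single[OF gE gg] by auto
  qed
  then have cg: "card (g ` {..<s}) = s" by (simp add: card_image)
  let ?E = "insert e\<^sub>1 (g ` {..<s})"
  have cE: "card ?E = s + 1" using ge(1) cg by (subst card_insert_disjoint) auto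
  have e2: "e\<^sub>2 \<notin> ?E" using ge(2) \<open>e\<^sub>1 \<noteq> e\<^sub>2\<close> by auto
  have EE: "edges G = insert e\<^sub>2 ?E" using E by auto
  then show "card (edges G) = s + 2" using cE e2 by simp
  have "card (e \<inter> f) \<le> 1" if "e \<in> ?E" "f \<in> ?E" "e \<noteq> f" for e f
  proof -
    have "e\<^sub>1 \<inter> g j = {u}" if "j < s" for j using g[OF that] by blast
    moreover have "g i \<inter> g j = {u}" if "i < s" "j < s" "g i \<noteq> g j" for i j
      using gg that by metis
    ultimately have "e \<inter> f = {u}" using that g by (elim insertE imageE) simp_all
    then show ?thesis by simp
  qed
  then have 1: "card (\<Union>e\<in>?E. pairs e) = (s + 1) * (k choose 2)"
    using card_UN_pairs_linear[of ?E k] fin K EE cE by simp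
  have f2: "finite e\<^sub>2" "card e\<^sub>2 = k" using fin K E by auto
  have "finite (\<Union>e\<in>?E. pairs e)" using fin EE by auto
  from card_Un_Int[OF this finite_pairs[OF f2(1)]]
  have 2: "(s + 1) * (k choose 2) + (k choose 2) =
      card ((\<Union>e\<in>?E. pairs e) \<union> pairs e\<^sub>2) + card ((\<Union>e\<in>?E. pairs e) \<inter> pairs e\<^sub>2)"
    using 1 f2 by (simp add: card_pairs)
  have "(\<Union>e\<in>?E. pairs e) \<inter> pairs e\<^sub>2 \<subseteq> {{u, w}}"
  proof (rule subsetI, elim IntE UN_E)
    fix T e assume "e \<in> ?E" "T \<in> pairs e" "T \<in> pairs e\<^sub>2"
    then have e: "e \<in> ?E" "T \<subseteq> e" "T \<subseteq> e\<^sub>2" "card T = 2" by (simp_all add: pairs_def)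
    have "e = e\<^sub>1"
    proof (rule ccontr)
      assume "e \<noteq> e\<^sub>1"
      then have "e \<inter> e\<^sub>2 = {u}" using e(1) g by auto
      then have "T \<subseteq> {u}" using e by blast
      then show False using card_mono[of "{u}" T] e(4) by simp
    qed
    then have "T \<subseteq> {u, w}" using e I by blast
    then have "T = {u, w}" using e(4) N by (intro card_subset_eq) auto
    then show "T \<in> {{u, w}}" by simp
  qed
  then have "card ((\<Union>e\<in>?E. pairs e) \<inter> pairs e\<^sub>2) \<le> 1" using card_mono[of "{{u, w}}"] by fastforce
  moreover have "(\<Union>e\<in>edges G. pairs e) = (\<Union>e\<in>?E. pairs e) \<union> pairs e\<^sub>2" using EE by auto
  ultimately show "(s + 2) * (k choose 2) \<le> card (\<Union>e\<in>edges G. pairs e) + 1" using 2 by simp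
qed

section \<open>The numbered candidates have the two shapes\<close>

lemma loose_cycle3_shape:
  assumes "k \<ge> 3"
  shows "triangle_shape k (loose_cycle3 k) {1..k} {k..2 * k - 1} (insert 1 {2 * k - 1..3 * k - 3})
    1 k (2 * k - 1)"
proof -
  obtain q where k: "k = Suc q" "q \<ge> 2" using assms by (cases k) auto
  have three: "{1..3::nat} = {1, 2, 3}" by auto
  have 1: "(\<lambda>j. if j = 3 * q + 1 then 1 else j) ` {1..Suc q} = {1..Suc q}"
    using k(2) by (auto simp: image_iff)
  have 2: "(\<lambda>j. if j = 3 * q + 1 then 1 else j) ` {q + 1..q + Suc q} = {Suc q..2 * q + 1}"
    using k(2) by (auto simp: image_iff)
  \<comment> \<open>Among the three index intervals only this one reaches \<open>3 * q + 1\<close>,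
    the index that stands for vertex 1.\<close>
  have 3: "(\<lambda>j. if j = 3 * q + 1 then 1 else j) ` {2 * q + 1..2 * q + Suc q} =
      insert 1 {2 * q + 1..3 * q}"
  proof -
    have "{2 * q + 1..2 * q + Suc q} = insert (3 * q + 1) {2 * q + 1..3 * q}" by auto
    moreover have "(\<lambda>j. if j = 3 * q + 1 then 1 else j) ` {2 * q + 1..3 * q} = {2 * q + 1..3 * q}"
      by (auto simp: image_iff)
    ultimately show ?thesis by (simp only: image_insert if_True refl)
  qed
  have E: "edges (loose_cycle3 k) = {{1..k}, {k..2 * k - 1}, insert 1 {2 * k - 1..3 * k - 3}}"
    unfolding loose_cycle3_def three using 1 2 3 k(1) by simp
  have V: "verts (loose_cycle3 k) = {1..3 * q}" by (simp add: loose_cycle3_def k)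
  show ?thesis unfolding triangle_shape_def E V using k by auto
qed

lemma pendant_cycle2_shape:
  assumes "k \<ge> 3"
  shows "star_shape k (pendant_cycle2 k s) {..<k} ({0, 1} \<union> {k..<2 * k - 2}) 0 1
    (\<lambda>j. insert 0 {(j + 2) * (k - 1)..<(j + 3) * (k - 1)}) s"
proof -
  obtain q where k: "k = Suc q" "q \<ge> 2" using assms by (cases k) auto
  let ?g = "\<lambda>j. insert 0 {(j + 2) * q..<(j + 3) * q}"
  \<comment> \<open>Blocks are recognised by the quotient by \<open>q = k - 1\<close>: pendant edge
    \<open>j\<close> consists of 0 and the numbers with quotient \<open>j + 2\<close>, while the
    cycle edges contain only quotients 0 and 1. Intersections then reduce to comparing
    quotients.\<close>
  have g: "x \<in> ?g j \<longleftrightarrow> x = 0 \<or> x div q = j + 2" for x j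
  proof -
    have "j + 2 \<le> x div q \<longleftrightarrow> (j + 2) * q \<le> x" "x div q < j + 3 \<longleftrightarrow> x < (j + 3) * q"
      using k(2) by (simp_all only: less_eq_div_iff_mult_less_eq div_less_iff_less_mult)
    moreover have "x div q = j + 2 \<longleftrightarrow> j + 2 \<le> x div q \<and> x div q < j + 3" by auto
    ultimately show ?thesis by (simp only: insert_iff atLeastLessThan_iff)
  qed
  have small: "x div q \<le> 1" if "x < 2 * q" for x
    using less_mult_imp_div_less[OF that] by simp
  have E: "edges (pendant_cycle2 k s) = {{..<k}, {0, 1} \<union> {k..<2 * k - 2}} \<union> ?g ` {..<s}"
    by (simp add: pendant_cycle2_def k)
  have V: "verts (pendant_cycle2 k s) = {..<(s + 2) * q}" by (simp add: pendant_cycle2_def k)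
  have U: "\<Union> (edges (pendant_cycle2 k s)) = {..<2 * q} \<union> (\<Union>j<s. ?g j)"
    unfolding E using k by auto
  have "{..<2 * q} \<union> (\<Union>j<s. ?g j) = {..<(s + 2) * q}"
  proof (intro equalityI subsetI)
    fix x assume "x \<in> {..<2 * q} \<union> (\<Union>j<s. ?g j)"
    then consider "x < 2 * q" | j where "j < s" "x \<in> ?g j" by blast
    then show "x \<in> {..<(s + 2) * q}"
    proof cases
      case 2
      then have "x = 0 \<or> x div q < s + 2" unfolding g by auto
      then show ?thesis using k(2) by (auto simp: div_less_iff_less_mult)
    qed (auto simp: algebra_simps)
  next
    fix x assume x: "x \<in> {..<(s + 2) * q}"
    show "x \<in> {..<2 * q} \<union> (\<Union>j<s. ?g j)"
    proof (cases "x < 2 * q")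
      case False
      then have "2 \<le> x div q" using k(2) by (simp add: less_eq_div_iff_mult_less_eq)
      moreover have "x div q < s + 2" using x by (simp add: less_mult_imp_div_less)
      ultimately have "x div q = (x div q - 2) + 2" "x div q - 2 < s" by simp_all
      then have "x \<in> ?g (x div q - 2)" unfolding g by simp
      with \<open>x div q - 2 < s\<close> show ?thesis by blast
    qed simp
  qed
  then have V': "verts (pendant_cycle2 k s) = \<Union> (edges (pendant_cycle2 k s))" using U V by simp
  have cg: "card (?g j) = k" for j
  proof -
    have "card (?g j) = Suc (card {(j + 2) * q..<(j + 3) * q})"
      using k(2) by (intro card_insert_disjoint) auto
    also have "\<dots> = k" using k(1) by (simp add: algebra_simps)
    finally show ?thesis .
  qed
  have c2: "card ({0, 1} \<union> {k..<2 * k - 2}) = k"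
    using k by (subst card_Un_disjoint) auto
  have K: "\<forall>e\<in>edges (pendant_cycle2 k s). card e = k" unfolding E using cg c2 by auto
  have I: "?g j \<inter> A = {0}" if "A \<subseteq> {..<2 * q}" "0 \<in> A" for j A
  proof (intro equalityI subsetI)
    fix x assume x: "x \<in> ?g j \<inter> A"
    then have "x div q \<le> 1" using that(1) by (intro small) auto
    moreover have "x = 0 \<or> x div q = j + 2" using x unfolding Int_iff g by simp
    ultimately show "x \<in> {0}" by auto
  qed (use that(2) in auto)
  have I1: "?g j \<inter> {..<k} = {0}" for j using k by (intro I) auto
  have I2: "?g j \<inter> ({0, 1} \<union> {k..<2 * k - 2}) = {0}" for j using k by (intro I) auto
  have J: "?g i \<inter> ?g j = {0}" if "i \<noteq> j" for i j
  proof (intro equalityI subsetI)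
    fix x assume x: "x \<in> ?g i \<inter> ?g j"
    then have "x = 0 \<or> x div q = i + 2" "x = 0 \<or> x div q = j + 2"
      unfolding Int_iff g by simp_all
    then show "x \<in> {0}" using that by auto
  qed auto
  have "{..<k} \<inter> ({0, 1} \<union> {k..<2 * k - 2}) = {0, 1}" using k by auto
  moreover have "k - 1 = q" using k(1) by simp
  ultimately show ?thesis unfolding star_shape_def
    by (simp only:) (intro conjI allI impI, (rule E V' K I1 I2 J | assumption | simp)+)
qed

section \<open>Hypergraphs with few far pairs\<close>

lemma near_pairs_le:
  assumes "finite E" "\<And>e. e \<in> E \<Longrightarrow> finite e \<and> card e = k"
  shows "card (\<Union>e\<in>E. pairs e) \<le> card E * (k choose 2)"
proof -
  have "card (\<Union>e\<in>E. pairs e) \<le> (\<Sum>e\<in>E. card (pairs e))" using assms(1) by (rule card_UN_le)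
  also have "\<dots> = (\<Sum>e\<in>E. k choose 2)" using assms(2) by (intro sum.cong) (auto simp: card_pairs)
  finally show ?thesis by simp
qed

text \<open>The incidences \<open>(d, T)\<close> of a pair \<open>T\<close> in an edge
  \<open>d\<close> number \<open>card E * (k choose 2)\<close> and project onto the covered pairs.
  If \<open>S\<close> lies in \<open>e\<close> and \<open>f\<close>, the projection stays onto after
  removing \<open>(f, S)\<close>, so at least one is lost. If only one is lost, it is injective on
  the remaining incidences, which rules out any further coincidence.\<close>

lemma overlapping_edges:
  assumes "finite E" and K: "\<And>e. e \<in> E \<Longrightarrow> finite e \<and> card e = k"
    and ef: "e \<in> E" "f \<in> E" "e \<noteq> f" "S \<in> pairs e" "S \<in> pairs f"
  shows "card (\<Union>e\<in>E. pairs e) + 1 \<le> card E * (k choose 2)"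
    and "card E * (k choose 2) \<le> card (\<Union>e\<in>E. pairs e) + 1 \<Longrightarrow>
      e' \<in> E \<Longrightarrow> f' \<in> E \<Longrightarrow> e' \<noteq> f' \<Longrightarrow> S' \<in> pairs e' \<Longrightarrow> S' \<in> pairs f' \<Longrightarrow>
      S' = S \<and> {e', f'} = {e, f}"
proof -
  let ?N = "\<Union>e\<in>E. pairs e" and ?Q = "Sigma E pairs"
  let ?D = "?Q - {(f, S)}"
  have finQ: "finite ?Q" using assms(1) K by (intro finite_SigmaI) auto
  have "card ?Q = (\<Sum>e\<in>E. card (pairs e))" using assms(1) K by (intro card_SigmaI) auto
  also have "\<dots> = (\<Sum>e\<in>E. k choose 2)" using K by (intro sum.cong) (auto simp: card_pairs)
  finally have cQ: "card ?Q = card E * (k choose 2)" by simp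
  have mem: "(f, S) \<in> ?Q" using ef by simp
  have cD: "card ?D + 1 = card ?Q" using card.remove[OF finQ mem] by simp
  have "snd ` ?D = ?N"
  proof (intro equalityI subsetI)
    fix T assume "T \<in> ?N"
    then obtain d where d: "d \<in> E" "T \<in> pairs d" by blast
    show "T \<in> snd ` ?D"
    proof (cases "(d, T) = (f, S)")
      case True
      then have "(e, T) \<in> ?D" using ef by simp
      then show ?thesis by (rule rev_image_eqI) simp
    next
      case False
      then have "(d, T) \<in> ?D" using d by simp
      then show ?thesis by (rule rev_image_eqI) simp
    qed
  qed auto
  moreover have finD: "finite ?D" using finQ by simp
  ultimately have "card ?N \<le> card ?D" using card_image_le[OF finD, of snd] by simp
  then show "card ?N + 1 \<le> card E * (k choose 2)" using cD cQ by simp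
  assume eq: "card E * (k choose 2) \<le> card ?N + 1"
    and ef': "e' \<in> E" "f' \<in> E" "e' \<noteq> f'" "S' \<in> pairs e'" "S' \<in> pairs f'"
  have "card (snd ` ?D) = card ?D" using \<open>snd ` ?D = ?N\<close> \<open>card ?N \<le> card ?D\<close> eq cD cQ by simp
  then have inj: "inj_on snd ?D" using finD by (intro eq_card_imp_inj_on)
  have same: "d = d'"
    if "d \<in> E" "d' \<in> E" "T \<in> pairs d" "T \<in> pairs d'" "(d, T) \<noteq> (f, S)" "(d', T) \<noteq> (f, S)"
    for d d' T
    using inj_onD[OF inj, of "(d, T)" "(d', T)"] that by simp
  \<comment> \<open>By injectivity one of the two incidences of \<open>S'\<close> is the removed
    one; the other is then compared with \<open>(e, S)\<close>, which was kept.\<close>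
  have "(e', S') = (f, S) \<or> (f', S') = (f, S)" using same[of e' f' S'] ef' by blast
  then show "S' = S \<and> {e', f'} = {e, f}"
  proof
    assume *: "(e', S') = (f, S)"
    then have "f' = e" using same[of f' e S] ef ef' by simp
    then show ?thesis using * by auto
  next
    assume *: "(f', S') = (f, S)"
    then have "e' = e" using same[of e' e S] ef ef' by simp
    then show ?thesis using * by auto
  qed
qed

lemma doubleton_in_far_pairs:
  assumes "x \<noteq> y" "x \<in> verts G" "y \<in> verts G"
    "\<And>e f. e \<in> edges G \<Longrightarrow> f \<in> edges G \<Longrightarrow> x \<in> e \<Longrightarrow> y \<in> f \<Longrightarrow> e \<inter> f = {}"
  shows "{x, y} \<in> far_pairs G"
  using assms unfolding far_pairs_def mem_Collect_eq
  by (intro conjI exI[of _ x] exI[of _ y]) auto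

text \<open>The order equals the lower bound of \<open>unicyclic_order_ge\<close>. In the structural
  arguments below, unicyclicity acts only through this equation.\<close>

locale tight_hypergraph =
  fixes G :: "'a hypergraph" and k :: nat
  assumes hypergraph: "hypergraph G" and connected: "connected G" and uniform: "uniform k G"
    and k_ge_3: "k \<ge> 3" and size_ge_2: "card (edges G) \<ge> 2"
    and order: "card (verts G) = card (edges G) * (k - 1)"
begin

section \<open>Degrees and vertices shared by several edges\<close>

definition deg :: "'a \<Rightarrow> nat" where
  "deg v = card {e \<in> edges G. v \<in> e}"

definition joints :: "'a set" where
  "joints = {v \<in> verts G. deg v \<ge> 2}"

lemma finite_verts: "finite (verts G)"
  and finite_edges: "finite (edges G)"
  using hypergraph by (auto simp: hypergraph_def intro: finite_subset)

lemma edge_sub: "e \<in> edges G \<Longrightarrow> e \<subseteq> verts G"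
  and edge_card: "e \<in> edges G \<Longrightarrow> card e = k"
  using hypergraph uniform by (auto simp: hypergraph_def uniform_def)

lemma edge_finite: "e \<in> edges G \<Longrightarrow> finite e"
  using finite_subset[OF edge_sub finite_verts] .

lemma order_gt: "card (verts G) > k"
proof -
  have "2 * (k - 1) \<le> card (verts G)" unfolding order using size_ge_2 by (intro mult_right_mono) auto
  then show ?thesis using k_ge_3 by linarith
qed

lemma Union_edges: "\<Union> (edges G) = verts G"
  using hypergraph connected order_gt k_ge_3 by (intro edges_cover) auto

lemma edge_neq_verts: "e \<in> edges G \<Longrightarrow> e \<noteq> verts G"
  using edge_card order_gt by auto

lemma deg_ge_1: "v \<in> verts G \<Longrightarrow> deg v \<ge> 1"
proof -
  assume "v \<in> verts G"
  then have "v \<in> \<Union> (edges G)" by (simp add: Union_edges)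
  then have "{e \<in> edges G. v \<in> e} \<noteq> {}" by blast
  then show ?thesis using finite_edges by (simp add: deg_def Suc_le_eq card_gt_0_iff)
qed

lemma joints_sub: "joints \<subseteq> verts G"
  by (auto simp: joints_def)

lemma jointI:
  assumes "e \<in> edges G" "f \<in> edges G" "e \<noteq> f" "v \<in> e" "v \<in> f"
  shows "v \<in> joints"
proof -
  have "card {e, f} \<le> deg v" unfolding deg_def
    using assms finite_edges by (intro card_mono) auto
  then show ?thesis using assms edge_sub by (auto simp: joints_def)
qed

lemma sum_deg: "finite A \<Longrightarrow> (\<Sum>v\<in>A. deg v) = (\<Sum>e\<in>edges G. card (e \<inter> A))"
  unfolding deg_def using finite_edges
  by (intro sum_multicount_gen) (auto intro!: arg_cong[where f = card])

text \<open>With \<open>m\<close> edges, the degrees sum to \<open>m * k\<close>, which is the order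
  plus \<open>m\<close>. Vertices outside \<open>joints\<close> contribute 1 each, so the joints
  have degree sum \<open>m + card joints\<close>. Counted by edges this is at least
  \<open>2 * m\<close>, counted by joints at least \<open>2 * card joints\<close>. Together these
  give \<open>card joints = m\<close> and equality term by term.\<close>

lemma no_pendant_edge:
  assumes "\<And>e. e \<in> edges G \<Longrightarrow> card (e \<inter> joints) \<ge> 2"
  shows "e \<in> edges G \<Longrightarrow> card (e \<inter> joints) = 2" and "v \<in> joints \<Longrightarrow> deg v = 2"
proof -
  let ?m = "card (edges G)"
  have finW: "finite joints" using joints_sub finite_verts by (rule finite_subset)
  have "(\<Sum>v\<in>verts G. deg v) = (\<Sum>e\<in>edges G. card (e \<inter> verts G))"
    using finite_verts by (rule sum_deg)
  also have "\<dots> = (\<Sum>e\<in>edges G. k)"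
    using edge_sub edge_card by (intro sum.cong) (auto simp: Int_absorb2)
  finally have "(\<Sum>v\<in>verts G. deg v) = ?m * k" by simp
  moreover have "(\<Sum>v\<in>verts G. deg v) = (\<Sum>v\<in>verts G - joints. deg v) + (\<Sum>v\<in>joints. deg v)"
    using joints_sub finite_verts by (rule sum.subset_diff)
  moreover have "deg v = 1" if "v \<in> verts G - joints" for v
    using deg_ge_1[of v] that by (auto simp: joints_def)
  then have "(\<Sum>v\<in>verts G - joints. deg v) = card (verts G - joints)" by simp
  moreover have "card (verts G - joints) = card (verts G) - card joints"
    using joints_sub finW by (intro card_Diff_subset)
  moreover have "card joints \<le> card (verts G)" using joints_sub finite_verts by (intro card_mono)
  moreover have "?m * k = ?m * (k - 1) + ?m"
    using k_ge_3 by (cases k) auto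
  ultimately have deg_sum: "(\<Sum>v\<in>joints. deg v) = ?m + card joints" using order by linarith
  have edge_sum: "(\<Sum>v\<in>joints. deg v) = (\<Sum>e\<in>edges G. card (e \<inter> joints))"
    using finW by (rule sum_deg)
  have ge1: "(\<Sum>e\<in>edges G. 2) \<le> (\<Sum>e\<in>edges G. card (e \<inter> joints))"
    using assms by (rule sum_mono)
  have ge2: "(\<Sum>v\<in>joints. 2) \<le> (\<Sum>v\<in>joints. deg v)"
    by (rule sum_mono) (simp add: joints_def)
  have "(\<Sum>e\<in>edges G. 2) = (\<Sum>e\<in>edges G. card (e \<inter> joints))"
    using ge1 ge2 deg_sum edge_sum by simp
  then show "card (e \<inter> joints) = 2" if "e \<in> edges G"
    using sum_mono_inv[of "\<lambda>_. 2" "edges G" "\<lambda>e. card (e \<inter> joints)" e] assms that finite_edges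
    by simp
  have "(\<Sum>v\<in>joints. 2) = (\<Sum>v\<in>joints. deg v)" using ge1 ge2 deg_sum edge_sum by simp
  moreover have "2 \<le> deg v" if "v \<in> joints" for v using that by (simp add: joints_def)
  ultimately show "deg v = 2" if "v \<in> joints"
    using sum_mono_inv[of "\<lambda>_. 2" joints deg v] that finW by metis
qed

lemma finite_far_pairs: "finite (far_pairs G)"
  using finite_verts by (auto simp: far_pairs_def)

lemma far_pairI:
  assumes "e \<in> edges G" "f \<in> edges G" "e \<inter> f = {}" "x \<in> e - joints" "y \<in> f - joints"
  shows "{x, y} \<in> far_pairs G"
proof -
  have "x \<noteq> y" "x \<in> verts G" "y \<in> verts G" using assms edge_sub by auto
  moreover have "e' = e" if "e' \<in> edges G" "x \<in> e'" for e' using jointI[of e' e x] that assms by auto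
  moreover have "f' = f" if "f' \<in> edges G" "y \<in> f'" for f' using jointI[of f' f y] that assms by auto
  ultimately show ?thesis using assms(3) by (intro doubleton_in_far_pairs) auto
qed

text \<open>Otherwise every edge has exactly two joints, each of degree 2, so it meets at most two
  other edges and, there being four, misses some edge. Two disjoint edges yield a far pair from
  vertices outside \<open>joints\<close>, and two different such pairs can be found.\<close>

lemma ex_pendant_edge:
  assumes "card (edges G) \<ge> 4" "card (far_pairs G) \<le> 1"
  shows "\<exists>e\<in>edges G. card (e \<inter> joints) \<le> 1"
proof (rule ccontr)
  assume *: "\<not> ?thesis"
  then have ge: "card (e \<inter> joints) \<ge> 2" if "e \<in> edges G" for e
    using that by (metis not_less_eq_eq Suc_1 One_nat_def)
  then have joints_card: "card (e \<inter> joints) = 2" if "e \<in> edges G" for e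
    using that by (intro no_pendant_edge(1))
  have deg_2: "deg v = 2" if "v \<in> joints" for v
    using ge that by (intro no_pendant_edge(2))
  have free: "\<exists>x. x \<in> e - joints" if "e \<in> edges G" for e
  proof (rule ccontr)
    assume "\<not> ?thesis"
    then have "e \<inter> joints = e" by blast
    then show False using joints_card[OF that] edge_card[OF that] k_ge_3 by simp
  qed
  have disjoint: "\<exists>f\<in>edges G. f \<noteq> e \<and> e \<inter> f = {}" if e: "e \<in> edges G" for e
  proof -
    obtain a b where ab: "e \<inter> joints = {a, b}" using joints_card[OF e] unfolding card_2_iff by blast
    let ?A = "\<lambda>v. {f \<in> edges G. v \<in> f} - {e}"
    have A: "card (?A v) = 1" "finite (?A v)" if "v \<in> e \<inter> joints" for v
      using deg_2[of v] that e finite_edges unfolding deg_def by (auto simp: card_Diff_singleton)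
    \<comment> \<open>These are the edges that can meet \<open>e\<close>, since a common vertex with
      another edge is one of the joints \<open>a\<close>, \<open>b\<close>; there are at most three
      of them.\<close>
    define X where "X = insert e (?A a \<union> ?A b)"
    have "card X \<le> Suc (card (?A a \<union> ?A b))"
      unfolding X_def using A(2) ab by (simp add: card_insert_if)
    also have "\<dots> \<le> Suc (card (?A a) + card (?A b))" using card_Un_le by auto
    also have "\<dots> = 3" using A(1)[of a] A(1)[of b] ab by simp
    finally have "card X < card (edges G)" using assms(1) by simp
    moreover have "finite X" unfolding X_def using A(2) ab by simp
    ultimately have "\<not> edges G \<subseteq> X" using card_mono[of X "edges G"] by linarith
    then obtain f where "f \<in> edges G" "f \<notin> X" by blast
    then have f: "f \<in> edges G" "f \<noteq> e" "a \<notin> f" "b \<notin> f" unfolding X_def by blast+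
    have "e \<inter> f = {}"
    proof (rule ccontr)
      assume "e \<inter> f \<noteq> {}"
      then obtain z where "z \<in> e" "z \<in> f" by blast
      then have "z \<in> e \<inter> joints" using jointI[of e f z] f e by simp
      then show False using ab f \<open>z \<in> f\<close> by auto
    qed
    then show ?thesis using f by blast
  qed
  obtain e where e: "e \<in> edges G" using assms(1) by fastforce
  obtain f where f: "f \<in> edges G" "e \<inter> f = {}" using disjoint[OF e] by blast
  have "\<not> edges G \<subseteq> {e, f}"
  proof
    assume "edges G \<subseteq> {e, f}"
    then have "card (edges G) \<le> card {e, f}" by (intro card_mono) auto
    also have "\<dots> \<le> 2" by (simp add: card_insert_if)
    finally show False using assms(1) by simp
  qed
  \<comment> \<open>Starting the second pair from an edge other than \<open>e\<close> and
    \<open>f\<close> makes it differ from the first, because \<open>z\<close> lies in no edge but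
    \<open>h\<close>. The edge \<open>g\<close> below may coincide with \<open>e\<close> or
    \<open>f\<close>.\<close>
  then obtain h where h: "h \<in> edges G" "h \<noteq> e" "h \<noteq> f" by blast
  obtain g where g: "g \<in> edges G" "h \<inter> g = {}" using disjoint[OF h(1)] by blast
  obtain x y z t where xyzt: "x \<in> e - joints" "y \<in> f - joints" "z \<in> h - joints" "t \<in> g - joints"
    using free e f(1) h(1) g(1) by metis
  have "{x, y} \<in> far_pairs G" "{z, t} \<in> far_pairs G"
    using far_pairI e f h(1) g xyzt by metis+
  then have "card {{x, y}, {z, t}} \<le> card (far_pairs G)"
    using finite_far_pairs by (intro card_mono) auto
  moreover have "z \<noteq> x" "z \<noteq> y" using jointI[of h e z] jointI[of h f z] e f h xyzt by auto
  then have "{x, y} \<noteq> {z, t}" by (auto simp: doubleton_eq_iff)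
  ultimately show False using assms(2) by simp
qed

text \<open>Let \<open>v\<close> be the only joint of an edge \<open>f\<close>. If no edge contains
  both \<open>v\<close> and \<open>y\<close>, every edge through \<open>y\<close> is disjoint from
  \<open>f\<close>, as it could meet \<open>f\<close> only in \<open>v\<close>. Each of the
  \<open>k - 1\<close> other vertices of \<open>f\<close> lies in \<open>f\<close> alone and hence
  forms a far pair with \<open>y\<close>, and one far pair too many arises.\<close>

lemma ex_central_vertex:
  assumes "card (edges G) \<ge> 4" "card (far_pairs G) \<le> 1"
  shows "\<exists>v\<in>verts G. verts G = \<Union>{e \<in> edges G. v \<in> e}"
proof -
  obtain f where f: "f \<in> edges G" "card (f \<inter> joints) \<le> 1" using ex_pendant_edge[OF assms] by blast
  have "f \<noteq> {}" using edge_card[OF f(1)] k_ge_3 by auto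
  then obtain e where e: "e \<in> edges G" "e \<inter> f \<noteq> {}" "\<not> e \<subseteq> f"
    using crossing_edge[OF hypergraph connected edge_sub[OF f(1)] _ edge_neq_verts[OF f(1)]] by blast
  then obtain v where v: "v \<in> e" "v \<in> f" by blast
  have "e \<noteq> f" using e(3) by auto
  then have "v \<in> joints" using jointI[OF e(1) f(1) _ v] by simp
  moreover have "finite (f \<inter> joints)" using edge_finite[OF f(1)] by simp
  ultimately have W: "f \<inter> joints = {v}"
    using f(2) v(2) by (intro card_seteq[symmetric]) auto
  have "y \<in> \<Union>{e \<in> edges G. v \<in> e}" if y: "y \<in> verts G" for y
  proof (rule ccontr)
    assume not: "\<not> ?thesis"
    have "{x, y} \<in> far_pairs G" if x: "x \<in> f - {v}" for x
    proof -
      have "y \<notin> f" using not v f(1) by blast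
      then have "x \<noteq> y" using x by auto
      have xV: "x \<in> verts G" using x edge_sub[OF f(1)] by auto
      have "d \<inter> d' = {}" if d: "d \<in> edges G" "d' \<in> edges G" "x \<in> d" "y \<in> d'" for d d'
      proof -
        have "x \<notin> joints" using x W by blast
        then have "d = f" using jointI[of d f x] d(1,3) f(1) x by auto
        moreover have "d' \<noteq> f" using \<open>y \<notin> f\<close> d(4) by auto
        then have "z = v" if "z \<in> f \<inter> d'" for z
          using jointI[of f d' z] f(1) d(2) that W by blast
        moreover have "v \<notin> d'" using not d by blast
        ultimately show ?thesis by blast
      qed
      then show ?thesis using \<open>x \<noteq> y\<close> xV y by (intro doubleton_in_far_pairs)
    qed
    then have "card ((\<lambda>x. {x, y}) ` (f - {v})) \<le> card (far_pairs G)"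
      using finite_far_pairs by (intro card_mono) auto
    moreover have "inj_on (\<lambda>x. {x, y}) (f - {v})" by (auto simp: inj_on_def doubleton_eq_iff)
    then have "card ((\<lambda>x. {x, y}) ` (f - {v})) = k - 1"
      using v edge_card[OF f(1)] by (simp add: card_image)
    ultimately show False using assms(2) k_ge_3 by simp
  qed
  then have "verts G = \<Union>{e \<in> edges G. v \<in> e}" using Union_edges by blast
  moreover have "v \<in> verts G" using v edge_sub[OF f(1)] by blast
  ultimately show ?thesis by blast
qed

text \<open>A bouquet of edges meeting only in \<open>v\<close> has \<open>1\<close> vertex modulo \<open>k - 1\<close>, whereas the order of
  \<open>G\<close> is a multiple of \<open>k - 1\<close>.\<close>

lemma central_vertex_overlap:
  assumes "v \<in> verts G" "verts G = \<Union>{e \<in> edges G. v \<in> e}"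
  shows "\<exists>e\<in>edges G. \<exists>f\<in>edges G. e \<noteq> f \<and> v \<in> e \<inter> f \<and> e \<inter> f \<noteq> {v}"
proof (rule ccontr)
  assume "\<not> ?thesis"
  then have int: "e \<inter> f = {v}" if "e \<in> edges G" "f \<in> edges G" "e \<noteq> f" "v \<in> e" "v \<in> f" for e f
    using that by blast
  let ?E = "{e \<in> edges G. v \<in> e}"
  have "card (\<Union>e\<in>?E. e - {v}) = (\<Sum>e\<in>?E. card (e - {v}))"
  proof (rule card_UN_disjoint)
    show "\<forall>e\<in>?E. \<forall>f\<in>?E. e \<noteq> f \<longrightarrow> (e - {v}) \<inter> (f - {v}) = {}"
    proof (intro ballI impI)
      fix e f assume "e \<in> ?E" "f \<in> ?E" "e \<noteq> f"
      then have "e \<inter> f = {v}" by (intro int) auto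
      then show "(e - {v}) \<inter> (f - {v}) = {}" by blast
    qed
  qed (use finite_edges edge_finite in auto)
  also have "\<dots> = (\<Sum>e\<in>?E. k - 1)" using edge_card edge_finite by (intro sum.cong) auto
  finally have "card (\<Union>e\<in>?E. e - {v}) = card ?E * (k - 1)" by simp
  moreover have "verts G = insert v (\<Union>e\<in>?E. e - {v})" using assms by blast
  moreover have "finite (\<Union>e\<in>?E. e - {v})" using finite_edges edge_finite by auto
  then have "card (insert v (\<Union>e\<in>?E. e - {v})) = Suc (card (\<Union>e\<in>?E. e - {v}))"
    by (rule card_insert_disjoint) blast
  ultimately have "card (verts G) = Suc (card ?E * (k - 1))" by (simp only:)
  then have "card (edges G) * (k - 1) = Suc (card ?E * (k - 1))" using order by simp
  then have "(k - 1) dvd 1" by (metis dvd_triv_right dvd_add_right_iff Suc_eq_plus1)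
  then show False using k_ge_3 by auto
qed

text \<open>If \<open>t\<close> edges pass through \<open>v\<close>, they cover at most
  \<open>1 + t * (k - 1)\<close> vertices, and one less because \<open>w\<close> is shared by two of
  them. As they cover all \<open>card (edges G) * (k - 1)\<close> vertices, \<open>t\<close> is the
  number of all edges.\<close>

lemma central_vertex_in_all_edges:
  assumes v: "verts G = \<Union>{e \<in> edges G. v \<in> e}"
    and ef: "e \<in> edges G" "f \<in> edges G" "e \<noteq> f" "v \<in> e" "v \<in> f" "w \<in> e" "w \<in> f" "w \<noteq> v"
    and d: "d \<in> edges G"
  shows "v \<in> d"
proof -
  let ?E = "{e \<in> edges G. v \<in> e}"
  have fin: "finite ?E" using finite_edges by simp
  have f: "f \<in> ?E" using ef by simp
  have "card (\<Union>e\<in>?E - {f}. e - {v}) \<le> (\<Sum>e\<in>?E - {f}. card (e - {v}))"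
    using fin by (intro card_UN_le) auto
  also have "\<dots> = (\<Sum>e\<in>?E - {f}. k - 1)" using edge_card edge_finite by (intro sum.cong) auto
  also have "\<dots> = (card ?E - 1) * (k - 1)" using f fin by simp
  finally have 1: "card (\<Union>e\<in>?E - {f}. e - {v}) \<le> (card ?E - 1) * (k - 1)" .
  have "card (f - {v, w}) = card f - card {v, w}"
    using ef by (intro card_Diff_subset) auto
  then have 2: "card (f - {v, w}) = k - 2" using edge_card[OF ef(2)] ef(8) by auto
  \<comment> \<open>The edge \<open>f\<close> is counted last and contributes at most
    \<open>k - 2\<close> new vertices, since \<open>w\<close> already occurs in
    \<open>e\<close>.\<close>
  have "verts G = insert v ((\<Union>e\<in>?E - {f}. e - {v}) \<union> (f - {v, w}))"
  proof (intro equalityI subsetI)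
    fix x assume "x \<in> verts G"
    then have "x \<in> \<Union>?E" using v by simp
    then obtain c where c: "c \<in> ?E" "x \<in> c" by blast
    show "x \<in> insert v ((\<Union>e\<in>?E - {f}. e - {v}) \<union> (f - {v, w}))"
    proof (cases "c = f \<and> x \<noteq> w")
      case True
      then show ?thesis using c by auto
    next
      case False
      then show ?thesis using c ef by (cases "c = f") auto
    qed
  next
    fix x assume "x \<in> insert v ((\<Union>e\<in>?E - {f}. e - {v}) \<union> (f - {v, w}))"
    then show "x \<in> verts G" using edge_sub f by blast
  qed
  then have "card (verts G) \<le> Suc (card ((\<Union>e\<in>?E - {f}. e - {v}) \<union> (f - {v, w})))"
    by (simp only:) (rule card_insert_le_m1, simp_all)
  also have "\<dots> \<le> Suc (card (\<Union>e\<in>?E - {f}. e - {v}) + card (f - {v, w}))"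
    using card_Un_le by auto
  also have "\<dots> \<le> Suc ((card ?E - 1) * (k - 1) + (k - 2))" using 1 2 by simp
  also have "\<dots> = card ?E * (k - 1)"
  proof -
    have "card ?E \<ge> 1" using f fin by (metis One_nat_def Suc_leI card_gt_0_iff empty_iff)
    then obtain c where "card ?E = Suc c" by (cases "card ?E") auto
    then show ?thesis using k_ge_3 by simp
  qed
  finally have "card (edges G) \<le> card ?E" using order k_ge_3 by simp
  then have "?E = edges G" using finite_edges by (intro card_seteq) auto
  then show ?thesis using d by blast
qed

end

section \<open>Comparison with the extremal shapes\<close>

text \<open>From 1 on, \<open>n choose 2\<close> is strictly increasing; at 0 and 1 it takes the
  same value.\<close>

lemma choose_two_cancel:
  assumes "n\<^sub>0 \<le> n" "n choose 2 \<le> n\<^sub>0 choose 2" "1 \<le> n\<^sub>0"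
  shows "n = n\<^sub>0"
proof (rule ccontr)
  assume "n \<noteq> n\<^sub>0"
  then have "Suc n\<^sub>0 choose 2 \<le> n choose 2" using assms(1) by (intro binomial_right_mono) simp
  moreover have "Suc n\<^sub>0 choose 2 = n\<^sub>0 + (n\<^sub>0 choose 2)" by (simp add: numeral_2_eq_2)
  ultimately show False using assms by simp
qed

lemma ex_pair:
  assumes "\<not> card A \<le> 1"
  shows "\<exists>S. S \<in> pairs A"
proof -
  have "2 \<le> card A" using assms by simp
  then obtain S where "S \<subseteq> A" "card S = 2" by (meson obtain_subset_with_card_n)
  then show ?thesis by (auto simp: pairs_def)
qed

text \<open>Here \<open>\<delta>\<close> bounds the number of pairs that \<open>H\<close> loses
  through overlapping edges: 0 for the triangle, 1 for the star. Comparing the lower bound for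
  \<open>G\<close> with the upper bound for \<open>H\<close> first fixes the order of
  \<open>G\<close>; the binomials then cancel and leave the bound on far pairs and lost
  pairs.\<close>

lemma minimal_bounds:
  assumes "k \<ge> 3" "card (edges G) \<ge> 2" and G: "hypergraph G" "uniform k G" "unicyclic G"
    and H: "hypergraph H" "\<Union> (edges H) = verts H" "card (verts H) = card (edges G) * (k - 1)"
    and meet: "\<And>e f. e \<in> edges H \<Longrightarrow> f \<in> edges H \<Longrightarrow> e \<inter> f \<noteq> {}"
    and near: "card (edges G) * (k choose 2) \<le> card (\<Union>e\<in>edges H. pairs e) + \<delta>" and "\<delta> \<le> 1"
    and le: "transmission G \<le> transmission H"
  shows "tight_hypergraph G k"
    and "card (far_pairs G) + card (edges G) * (k choose 2) \<le> card (\<Union>e\<in>edges G. pairs e) + \<delta>"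
proof -
  let ?m = "card (edges G)" and ?N = "card (\<Union>e\<in>edges G. pairs e)"
  have con: "connected G" using G(3) by (simp add: unicyclic_def)
  have "finite (verts G)" "edges G \<subseteq> Pow (verts G)" using G(1) by (simp_all add: hypergraph_def)
  then have fin: "finite (edges G)" "\<And>e. e \<in> edges G \<Longrightarrow> finite e \<and> card e = k"
    using G(2) by (auto simp: uniform_def intro: finite_subset)
  have N: "?N \<le> ?m * (k choose 2)" using fin by (rule near_pairs_le)
  have lower: "2 * (card (verts G) choose 2) + card (far_pairs G) \<le> transmission G + ?N"
    using G(1) con by (rule transmission_ge)
  have upper: "transmission H + card (\<Union>e\<in>edges H. pairs e) \<le> 2 * (card (verts H) choose 2)"
    using H(1,2) meet by (rule transmission_le)
  have main: "2 * (card (verts G) choose 2) + card (far_pairs G) + ?m * (k choose 2)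
      \<le> 2 * (?m * (k - 1) choose 2) + ?N + \<delta>"
    using lower upper near le unfolding H(3) by linarith
  \<comment> \<open>Both binomials are doubled, so an excess of \<open>\<delta> \<le> 1\<close>
    disappears by integrality.\<close>
  then have "card (verts G) choose 2 \<le> ?m * (k - 1) choose 2" using N assms(11) by linarith
  moreover have "?m * (k - 1) \<le> card (verts G)"
    using G assms(1,2) by (intro unicyclic_order_ge) auto
  moreover have "1 \<le> ?m * (k - 1)" using assms(1,2) by (simp add: Suc_le_eq)
  ultimately have n: "card (verts G) = ?m * (k - 1)" by (intro choose_two_cancel)
  then show "tight_hypergraph G k" using assms(1,2) G(1,2) con by unfold_locales
  show "card (far_pairs G) + ?m * (k choose 2) \<le> ?N + \<delta>" using main unfolding n by linarith
qed

text \<open>By inclusion-exclusion with \<open>3 * k - 3\<close> vertices, the sizes of the three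
  pairwise intersections minus that of the triple one sum to 3. Each pairwise size is at most 1, so
  all are 1 and the triple intersection is empty.\<close>

lemma triangle_if_linear:
  assumes "k \<ge> 3" and E: "edges G = {e, f, h}" "card (edges G) = 3" "\<Union> (edges G) = verts G"
    and K: "\<And>d. d \<in> edges G \<Longrightarrow> card d = k" and n: "card (verts G) = 3 * (k - 1)"
    and lin: "\<And>d d'. d \<in> edges G \<Longrightarrow> d' \<in> edges G \<Longrightarrow> d \<noteq> d' \<Longrightarrow> card (d \<inter> d') \<le> 1"
  shows "\<exists>a b c. triangle_shape k G e f h a b c"
proof -
  have ne: "e \<noteq> f" "e \<noteq> h" "f \<noteq> h" using E(1,2) by (auto simp: card_insert_if split: if_splits)
  have c: "card e = k" "card f = k" "card h = k" using K E(1) by simp_all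
  then have fin: "finite e" "finite f" "finite h" using assms(1) by (auto intro: card_ge_0_finite)
  have x: "card (e \<inter> f) \<le> 1" "card (f \<inter> h) \<le> 1" "card (h \<inter> e) \<le> 1"
    using lin ne E(1) by simp_all
  have V: "verts G = e \<union> f \<union> h" using E(3) unfolding E(1) by (simp add: Un_assoc)
  have "card e + card f = card (e \<union> f) + card (e \<inter> f)" using fin by (intro card_Un_Int)
  moreover have "card (e \<union> f) + card h = card (e \<union> f \<union> h) + card ((e \<union> f) \<inter> h)"
    using fin by (intro card_Un_Int) auto
  moreover have "card (h \<inter> e) + card (f \<inter> h) = card ((h \<inter> e) \<union> (f \<inter> h)) + card ((h \<inter> e) \<inter> (f \<inter> h))"
    using fin by (intro card_Un_Int) auto
  moreover have "(h \<inter> e) \<union> (f \<inter> h) = (e \<union> f) \<inter> h" by auto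
  moreover have "card (e \<union> f \<union> h) = 3 * k - 3" using n V by (simp add: diff_mult_distrib2)
  ultimately have "card (e \<inter> f) = 1" "card (f \<inter> h) = 1" "card (h \<inter> e) = 1"
    and triple: "card ((h \<inter> e) \<inter> (f \<inter> h)) = 0"
    using x c assms(1) by simp_all
  then obtain a b c' where abc: "h \<inter> e = {a}" "e \<inter> f = {b}" "f \<inter> h = {c'}"
    by (metis card_1_singletonE)
  have "(h \<inter> e) \<inter> (f \<inter> h) = {}" using triple fin by simp
  then have "a \<notin> f" "b \<notin> h" using abc by blast+
  then have "a \<noteq> b" "a \<noteq> c'" "b \<noteq> c'" using abc by blast+
  then show ?thesis unfolding triangle_shape_def using E(1) V c abc by blast
qed

section \<open>Recognising the star\<close>

context tight_hypergraph
begin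

lemma star_shape_if_central:
  assumes ef: "e \<in> edges G" "f \<in> edges G" "e \<noteq> f" "e \<inter> f = {u, w}" "u \<noteq> w"
    and u: "\<And>d. d \<in> edges G \<Longrightarrow> u \<in> d"
    and int: "\<And>d d'. d \<in> edges G \<Longrightarrow> d' \<in> edges G \<Longrightarrow> d \<noteq> d' \<Longrightarrow>
      {d, d'} \<noteq> {e, f} \<Longrightarrow> d \<inter> d' = {u}"
  shows "\<exists>g. star_shape k G e f u w g (card (edges G) - 2)"
proof -
  let ?R = "edges G - {e, f}" and ?s = "card (edges G) - 2"
  have "card ?R = ?s" using ef finite_edges by (simp add: card_Diff_subset)
  moreover obtain g where "bij_betw g {0..<card ?R} ?R"
    using ex_bij_betw_nat_finite[of ?R] finite_edges by auto
  ultimately have g: "bij_betw g {..<?s} ?R" by (simp add: atLeast0LessThan)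
  then have img: "g ` {..<?s} = ?R" by (simp add: bij_betw_def)
  have gR: "g j \<in> edges G \<and> g j \<noteq> e \<and> g j \<noteq> f" if "j < ?s" for j
  proof -
    have "g j \<in> g ` {..<?s}" using that by simp
    then show ?thesis unfolding img by simp
  qed
  have 1: "edges G = {e, f} \<union> g ` {..<?s}" unfolding img using ef by blast
  have 2: "g j \<inter> e = {u} \<and> g j \<inter> f = {u}" if "j < ?s" for j
  proof -
    have gj: "g j \<in> edges G" "g j \<noteq> e" "g j \<noteq> f" using gR[OF that] by simp_all
    have "{g j, e} \<noteq> {e, f}" "{g j, f} \<noteq> {e, f}"
      using gj ef(3) unfolding doubleton_eq_iff by simp_all
    then show ?thesis
      using int[OF gj(1) ef(1) gj(2)] int[OF gj(1) ef(2) gj(3)] by (intro conjI)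
  qed
  have 3: "g i \<inter> g j = {u}" if "i < ?s" "j < ?s" "i \<noteq> j" for i j
  proof -
    have "g i \<noteq> g j" using g that unfolding bij_betw_def inj_on_def by blast
    moreover have "{g i, g j} \<noteq> {e, f}" using gR[OF that(1)] unfolding doubleton_eq_iff by simp
    moreover have "g i \<in> edges G" "g j \<in> edges G" using gR that(1,2) by simp_all
    ultimately show ?thesis by (intro int)
  qed
  have "star_shape k G e f u w g ?s"
    unfolding star_shape_def
  proof (intro conjI ballI allI impI)
    show "edges G = {e, f} \<union> g ` {..<?s}" by (rule 1)
    show "g j \<inter> e = {u}" "g j \<inter> f = {u}" if "j < ?s" for j using 2[OF that] by simp_all
  qed (use 3 Union_edges edge_card ef in simp_all)
  then show ?thesis by (intro exI)
qed

text \<open>Two \<open>k\<close>-sets covering \<open>2 * (k - 1)\<close> vertices share exactly two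
  of them.\<close>

lemma star_if_two_edges:
  assumes "card (edges G) = 2"
  shows "\<exists>e f u w g. star_shape k G e f u w g 0"
proof -
  obtain e f where E: "edges G = {e, f}" "e \<noteq> f" using assms by (auto simp: card_2_iff)
  then have c: "card e = k" "card f = k" "finite e" "finite f" using edge_card edge_finite by auto
  have "card e + card f = card (e \<union> f) + card (e \<inter> f)" using c by (intro card_Un_Int)
  moreover have "e \<union> f = verts G" using Union_edges E by simp
  ultimately have "card (e \<inter> f) = 2" using c order assms k_ge_3 by simp
  then obtain u w where uw: "e \<inter> f = {u, w}" "u \<noteq> w" unfolding card_2_iff by blast
  have "\<exists>g. star_shape k G e f u w g (card (edges G) - 2)"
  proof (rule star_shape_if_central)
    show "u \<in> d" if "d \<in> edges G" for d using that E uw by blast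
    show "d \<inter> d' = {u}"
      if "d \<in> edges G" "d' \<in> edges G" "d \<noteq> d'" "{d, d'} \<noteq> {e, f}" for d d'
      using that unfolding E(1) by (elim insertE emptyE) (simp_all add: insert_commute)
  qed (use E uw in simp_all)
  then show ?thesis unfolding assms by (intro exI[of _ e] exI[of _ f] exI[of _ u] exI[of _ w]) simp
qed

text \<open>The overlap of two edges in \<open>v\<close> and \<open>w\<close> uses up the single
  permitted repetition of a pair. Hence no other two edges share a pair, and since all edges contain
  \<open>v\<close>, they meet in \<open>v\<close> only.\<close>

lemma star_if_few_far_pairs:
  assumes "card (edges G) \<ge> 4"
    and far: "card (far_pairs G) + card (edges G) * (k choose 2) \<le> card (\<Union>e\<in>edges G. pairs e) + 1"
  shows "\<exists>e f u w g. star_shape k G e f u w g (card (edges G) - 2)"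
proof -
  have fin: "finite d \<and> card d = k" if "d \<in> edges G" for d using that edge_card edge_finite by simp
  have "card (\<Union>e\<in>edges G. pairs e) \<le> card (edges G) * (k choose 2)"
    using finite_edges fin by (rule near_pairs_le)
  then have "card (far_pairs G) \<le> 1" using far by linarith
  then obtain v where v: "v \<in> verts G" "verts G = \<Union>{e \<in> edges G. v \<in> e}"
    using ex_central_vertex[OF assms(1)] by blast
  obtain e f where ef: "e \<in> edges G" "f \<in> edges G" "e \<noteq> f" and vef: "v \<in> e \<inter> f" "e \<inter> f \<noteq> {v}"
    using central_vertex_overlap[OF v] by blast
  obtain w where w: "w \<in> e \<inter> f" "w \<noteq> v" using vef by blast
  have S: "{v, w} \<in> pairs e" "{v, w} \<in> pairs f" using vef w by auto
  have tight: "card (edges G) * (k choose 2) \<le> card (\<Union>e\<in>edges G. pairs e) + 1"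
    using far by linarith
  \<comment> \<open>Applied to \<open>e\<close> and \<open>f\<close> themselves, this also shows
    that they share no third vertex.\<close>
  have unique: "{x, y} = {v, w} \<and> {d, d'} = {e, f}"
    if "d \<in> edges G" "d' \<in> edges G" "d \<noteq> d'" "x \<in> d \<inter> d'" "y \<in> d \<inter> d'" "x \<noteq> y" for x y d d'
    using overlapping_edges(2)[OF finite_edges fin ef S tight that(1-3), of "{x, y}"] that(4-6) by simp
  have "\<exists>g. star_shape k G e f v w g (card (edges G) - 2)"
  proof (rule star_shape_if_central[OF ef])
    show "e \<inter> f = {v, w}"
    proof (intro equalityI subsetI)
      fix z assume z: "z \<in> e \<inter> f"
      then have "z \<noteq> v \<Longrightarrow> {v, z} = {v, w}" using unique[OF ef vef(1) z] by simp
      then show "z \<in> {v, w}" by auto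
    qed (use vef w in auto)
    show "v \<in> d" if "d \<in> edges G" for d
      using central_vertex_in_all_edges[OF v(2) ef, of w d] vef w that by simp
    then have all: "v \<in> d" if "d \<in> edges G" for d using that .
    show "d \<inter> d' = {v}"
      if d: "d \<in> edges G" "d' \<in> edges G" "d \<noteq> d'" "{d, d'} \<noteq> {e, f}" for d d'
    proof (intro equalityI subsetI)
      fix z assume "z \<in> d \<inter> d'"
      then show "z \<in> {v}" using unique[OF d(1-3), of v z] all d by auto
    qed (use all d in auto)
  qed (use w in auto)
  then show ?thesis by blast
qed

end

theorem theorem3p1:
  fixes G :: "'a hypergraph" and k m :: nat
  assumes "k \<ge> 3" and "m \<ge> 2"
    and "hypergraph G" and "uniform k G" and "unicyclic G" and "card (edges G) = m"
    and "\<And>H :: nat hypergraph.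
           hypergraph H \<Longrightarrow> uniform k H \<Longrightarrow> unicyclic H \<Longrightarrow> card (edges H) = m \<Longrightarrow>
           transmission G \<le> transmission H"
  shows "(m = 3 \<longrightarrow> isomorphic G (loose_cycle3 k)) \<and>
         (m = 2 \<or> m \<ge> 4 \<longrightarrow> isomorphic G (pendant_cycle2 k (m - 2)))"
proof (intro conjI impI)
  assume m: "m = 3"
  let ?H = "loose_cycle3 k"
  obtain d\<^sub>1 d\<^sub>2 d\<^sub>3 a b c where shape: "triangle_shape k ?H d\<^sub>1 d\<^sub>2 d\<^sub>3 a b c"
    using loose_cycle3_shape[OF assms(1)] by blast
  have HE: "edges ?H = {d\<^sub>1, d\<^sub>2, d\<^sub>3}" and HV: "verts ?H = d\<^sub>1 \<union> d\<^sub>2 \<union> d\<^sub>3"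
    and HK: "card d\<^sub>1 = k" "card d\<^sub>2 = k" "card d\<^sub>3 = k"
    and HI: "d\<^sub>3 \<inter> d\<^sub>1 = {a}" "d\<^sub>1 \<inter> d\<^sub>2 = {b}" "d\<^sub>2 \<inter> d\<^sub>3 = {c}"
    using shape by (simp_all add: triangle_shape_def)
  have HU: "\<Union> (edges ?H) = verts ?H" unfolding HE HV by auto
  have Hn: "card (verts ?H) = 3 * (k - 1)" by (simp add: loose_cycle3_def)
  have H: "hypergraph ?H"
    unfolding hypergraph_def using HU assms(1) by (auto simp: loose_cycle3_def)
  have "uniform k ?H" unfolding uniform_def HE using HK by simp
  moreover have "unicyclic ?H" using H shape by (rule triangle_unicyclic)
  moreover have near: "card (edges ?H) = 3" "card (\<Union>e\<in>edges ?H. pairs e) = 3 * (k choose 2)"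
    using triangle_near_pairs[OF shape assms(1)] by simp_all
  ultimately have le: "transmission G \<le> transmission ?H" using assms(7) H m by simp
  have meet: "e \<inter> f \<noteq> {}" if "e \<in> edges ?H" "f \<in> edges ?H" for e f
  proof -
    have "a \<in> d\<^sub>3" "a \<in> d\<^sub>1" "b \<in> d\<^sub>1" "b \<in> d\<^sub>2" "c \<in> d\<^sub>2" "c \<in> d\<^sub>3" using HI by blast+
    then show ?thesis using that unfolding HE by auto
  qed
  \<comment> \<open>No pair is repeated in the triangle, so the comparison with
    \<open>\<delta> = 0\<close> forbids two edges of \<open>G\<close> from sharing a pair.\<close>
  have tight: "tight_hypergraph G k"
    and far: "card (far_pairs G) + card (edges G) * (k choose 2) \<le> card (\<Union>e\<in>edges G. pairs e) + 0"
    using minimal_bounds[of k G ?H 0] assms(1,3-6) m H HU Hn meet near le by simp_all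
  interpret tight_hypergraph G k by (rule tight)
  have fin: "finite d \<and> card d = k" if "d \<in> edges G" for d using that edge_card edge_finite by simp
  have lin: "card (d \<inter> d') \<le> 1" if "d \<in> edges G" "d' \<in> edges G" "d \<noteq> d'" for d d'
  proof (rule ccontr)
    assume "\<not> ?thesis"
    then obtain S where "S \<in> pairs (d \<inter> d')" using ex_pair by blast
    then have "S \<in> pairs d" "S \<in> pairs d'" by (simp_all add: pairs_def)
    then show False using overlapping_edges(1)[OF finite_edges fin that] far by simp
  qed
  obtain e f h where "edges G = {e, f, h}" using assms(6) m by (auto simp: card_3_iff)
  then obtain a' b' c' where "triangle_shape k G e f h a' b' c'"
    using triangle_if_linear[OF assms(1), of G e f h] assms(6) m Union_edges edge_card order lin by auto
  then show "isomorphic G ?H" by (rule isomorphic_if_triangle[OF assms(1) _ shape])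
next
  assume m: "m = 2 \<or> m \<ge> 4"
  let ?H = "pendant_cycle2 k (m - 2)"
  obtain d\<^sub>1 d\<^sub>2 u w h where shape: "star_shape k ?H d\<^sub>1 d\<^sub>2 u w h (m - 2)"
    using pendant_cycle2_shape[OF assms(1)] by blast
  have HU: "\<Union> (edges ?H) = verts ?H" and HK: "\<forall>e\<in>edges ?H. card e = k"
    using shape by (simp_all add: star_shape_def)
  have HE: "edges ?H = {d\<^sub>1, d\<^sub>2} \<union> h ` {..<m - 2}" and HI: "d\<^sub>1 \<inter> d\<^sub>2 = {u, w}"
    and Hh: "\<And>j. j < m - 2 \<Longrightarrow> h j \<inter> d\<^sub>1 = {u}"
    using shape by (simp_all add: star_shape_def)
  have "m - 2 + 2 = m" using assms(2) by simp
  then have Hn: "card (verts ?H) = m * (k - 1)" unfolding pendant_cycle2_def by simp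
  have "finite (verts ?H)" by (simp add: pendant_cycle2_def)
  moreover have "verts ?H \<noteq> {}" using Hn assms(1,2) by (intro notI) simp
  ultimately have H: "hypergraph ?H" unfolding hypergraph_def using HU by auto
  have "uniform k ?H" unfolding uniform_def using HK .
  moreover have "unicyclic ?H" using H assms(1) shape by (rule star_unicyclic)
  moreover have near: "card (edges ?H) = m"
    "m * (k choose 2) \<le> card (\<Union>e\<in>edges ?H. pairs e) + 1"
    using star_near_pairs[OF shape assms(1)] unfolding \<open>m - 2 + 2 = m\<close> by simp_all
  ultimately have le: "transmission G \<le> transmission ?H" using assms(7) H by simp
  have "u \<in> e" if "e \<in> edges ?H" for e using that HI Hh unfolding HE by blast
  then have meet: "e \<inter> f \<noteq> {}" if "e \<in> edges ?H" "f \<in> edges ?H" for e f using that by blast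
  \<comment> \<open>The value 1 for \<open>\<delta>\<close> accounts for the pair lying in both
    cycle edges of the star.\<close>
  have tight: "tight_hypergraph G k"
    and far: "card (far_pairs G) + card (edges G) * (k choose 2) \<le> card (\<Union>e\<in>edges G. pairs e) + 1"
    using minimal_bounds[of k G ?H 1] assms(1-6) H HU Hn meet near le by simp_all
  interpret tight_hypergraph G k by (rule tight)
  have "\<exists>e f u w g. star_shape k G e f u w g (m - 2)"
    using m
  proof
    assume "m = 2"
    then show ?thesis using star_if_two_edges assms(6) by simp
  next
    assume "m \<ge> 4"
    then show ?thesis using star_if_few_far_pairs far assms(6) by simp
  qed
  then obtain e f u' w' g where "star_shape k G e f u' w' g (m - 2)" by (elim exE)
  then show "isomorphic G ?H" by (rule isomorphic_if_star[OF assms(1) _ shape])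
qed

end
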